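(* Let $(G,\rho)$ be a unimodular random rooted graph, and let $p_n$ denote the $n$-step transition function of the simple random walk on $G$. Suppose that $$\mathbf E\Big[\deg(\rho)\cdot\sum_{n\ge 0}p_n(\rho,\rho)\Big]<\infty .$$ Then $G$ has the discrete finite collision property and the continuous finite collision property almost surely.
   Context: All graphs are unoriented, locally finite, connected, with countable vertex set, no loops and at most one edge between any two vertices. For $G=(V,E)$ write $x\sim y$ if $\{x,y\}\in E$, and $\deg(x)$ for the degree of $x$. Simple random walk. The discrete-time simple random walk on $G$ is the Markov chain on $V$ with transition function $p(x,y)=\deg(x)^{-1}\mathbf 1_{\{x\sim y\}}$; $p_n$ is its $n$-step transition function. The continuous-time simple random walk on $G$ is the continuous-time Markov chain on $V$ that jumps from $x$ to $y$ at rate $p(x,y)$. Collision properties. $G$ has the discrete finite collision property if for every $x\in V$ two independent discrete-time simple random walks $(X_n),(Y_n)$ both started from $x$ satisfy $\mathbb P(|\{n\in\mathbb N:X_n=Y_n\}|<\infty)=1$. $G$ has the continuous finite collision property if for every $x\in V$ two independent continuous-time simple random walks $(X_t),(Y_t)$ both started from $x$ satisfy $\mathbb P(|\{t\ge 0: X_{t^-}\ne Y_{t^-},\ X_t=Y_t\}|<\infty)=1$. Unimodularity. A rooted graph is a pair $(G,\rho)$ with $\rho\in V(G)$. $\mathcal G_\bullet$ is the set of isomorphism classes of (locally finite, connected) rooted graphs with the local metric $d_{\mathrm{loc}}((G_1,\rho_1),(G_2,\rho_2))=\inf\{1/(n+1): n\in\mathbb N_0,\ (B_{G_1}(\rho_1,n),\rho_1)\simeq(B_{G_2}(\rho_2,n),\rho_2)\}$,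 where $B_G(x,n)$ is the graph-distance ball and $\simeq$ is isomorphism of rooted graphs. $\mathcal G_{\bullet\bullet}$ is the analogous Polish space of isomorphism classes of graphs with two distinguished ordered vertices $(G,x,y)$. A random rooted graph is a random variable with values in $\mathcal G_\bullet$; $\mathbf P,\mathbf E$ denote its probability and expectation. It is unimodular if for every Borel $f:\mathcal G_{\bullet\bullet}\to[0,\infty]$, $\mathbf E[\sum_{v\in V}f(G,\rho,v)]=\mathbf E[\sum_{u\in V}f(G,u,\rho)]$. *)

theory Defs
  imports "HOL-Probability.Probability" "HOL-Library.Diagonal_Subsequence"
begin

section \<open>Graphs\<close>

datatype 'v graph = Graph (verts: "'v set") (edges: "'v set set")

definition adj :: "'v graph \<Rightarrow> 'v \<Rightarrow> 'v \<Rightarrow> bool" where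
  "adj G x y \<longleftrightarrow> {x, y} \<in> edges G"

definition vertex_degree :: "'v graph \<Rightarrow> 'v \<Rightarrow> nat" where
  "vertex_degree G x = card {y. adj G x y}"

definition simple_graph :: "'v graph \<Rightarrow> bool" where
  "simple_graph G \<longleftrightarrow> (\<forall>e\<in>edges G. e \<subseteq> verts G \<and> card e = 2)"

definition locally_finite :: "'v graph \<Rightarrow> bool" where
  "locally_finite G \<longleftrightarrow> (\<forall>x\<in>verts G. finite {y. adj G x y})"

definition connected_graph :: "'v graph \<Rightarrow> bool" where
  "connected_graph G \<longleftrightarrow> (\<forall>x\<in>verts G. \<forall>y\<in>verts G. (adj G)\<^sup>*\<^sup>* x y)"

definition lf_graph :: "'v graph \<Rightarrow> bool" where
  "lf_graph G \<longleftrightarrow>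
     countable (verts G) \<and> simple_graph G \<and> locally_finite G \<and> connected_graph G"

definition gdist :: "'v graph \<Rightarrow> 'v \<Rightarrow> 'v \<Rightarrow> nat" where
  "gdist G x y = (LEAST n. (adj G ^^ n) x y)"

definition gball :: "'v graph \<Rightarrow> 'v \<Rightarrow> nat \<Rightarrow> 'v graph" where
  "gball G x n =
     (let B = {y \<in> verts G. gdist G x y \<le> n} in Graph B {e \<in> edges G. e \<subseteq> B})"

definition graph_iso :: "('v \<Rightarrow> 'w) \<Rightarrow> 'v graph \<Rightarrow> 'w graph \<Rightarrow> bool" where
  "graph_iso \<phi> G H \<longleftrightarrow> bij_betw \<phi> (verts G) (verts H) \<and>
     (\<forall>x\<in>verts G. \<forall>y\<in>verts G. adj G x y \<longleftrightarrow> adj H (\<phi> x) (\<phi> y))"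

text \<open>
  Isomorphism of graphs with a list of distinguished vertices. The distinguished vertices must
  belong to the graphs; in particular a ball around \<open>x\<close> that does not contain \<open>y\<close> is not
  isomorphic, as a graph with distinguished vertices \<open>[x, y]\<close>, to anything.
\<close>

definition marked_iso :: "'v graph \<Rightarrow> 'v list \<Rightarrow> 'w graph \<Rightarrow> 'w list \<Rightarrow> bool" where
  "marked_iso G xs H ys \<longleftrightarrow> set xs \<subseteq> verts G \<and> (\<exists>\<phi>. graph_iso \<phi> G H \<and> map \<phi> xs = ys)"

lemma adj_sym: "adj G x y \<longleftrightarrow> adj G y x"
  by (simp add: adj_def insert_commute)

lemma adj_verts: "simple_graph G \<Longrightarrow> adj G x y \<Longrightarrow> x \<in> verts G \<and> y \<in> verts G"
  by (force simp: simple_graph_def adj_def)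

lemma marked_iso_refl: "set xs \<subseteq> verts G \<Longrightarrow> marked_iso G xs G xs"
  unfolding marked_iso_def graph_iso_def by (auto intro!: exI[of _ id])

lemma graph_iso_inv:
  assumes "graph_iso \<phi> G H"
  shows "graph_iso (inv_into (verts G) \<phi>) H G"
proof -
  let ?\<psi> = "inv_into (verts G) \<phi>"
  have b: "bij_betw \<phi> (verts G) (verts H)" using assms by (simp add: graph_iso_def)
  have "adj H u v \<longleftrightarrow> adj G (?\<psi> u) (?\<psi> v)" if "u \<in> verts H" "v \<in> verts H" for u v
  proof -
    have "?\<psi> u \<in> verts G" "?\<psi> v \<in> verts G" "\<phi> (?\<psi> u) = u" "\<phi> (?\<psi> v) = v"
      using b that by (auto simp: bij_betw_def f_inv_into_f inv_into_into)
    with assms show ?thesis by (metis graph_iso_def)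
  qed
  with b show ?thesis by (simp add: graph_iso_def bij_betw_inv_into)
qed

lemma marked_iso_sym: "marked_iso G xs H ys \<Longrightarrow> marked_iso H ys G xs"
proof -
  assume "marked_iso G xs H ys"
  then obtain \<phi> where xs: "set xs \<subseteq> verts G" and \<phi>: "graph_iso \<phi> G H" "map \<phi> xs = ys"
    by (auto simp: marked_iso_def)
  have b: "bij_betw \<phi> (verts G) (verts H)" using \<phi> by (simp add: graph_iso_def)
  have "map (inv_into (verts G) \<phi>) ys = xs"
    unfolding \<phi>(2)[symmetric] map_map using xs b
    by (intro map_idI) (auto simp: bij_betw_def)
  moreover have "set ys \<subseteq> verts H"
    using xs bij_betwE[OF b] unfolding \<phi>(2)[symmetric] set_map by blast
  ultimately show ?thesis
    using graph_iso_inv[OF \<phi>(1)] by (auto simp: marked_iso_def)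
qed

lemma marked_iso_trans:
  assumes "marked_iso G xs H ys" "marked_iso H ys K zs"
  shows "marked_iso G xs K zs"
proof -
  from assms obtain \<phi> \<psi> where xs: "set xs \<subseteq> verts G"
    and \<phi>: "graph_iso \<phi> G H" "map \<phi> xs = ys" and \<psi>: "graph_iso \<psi> H K" "map \<psi> ys = zs"
    by (auto simp: marked_iso_def)
  have "graph_iso (\<psi> \<circ> \<phi>) G K"
    using \<phi>(1) \<psi>(1) unfolding graph_iso_def
    by (auto intro: bij_betw_trans dest: bij_betwE)
  with xs \<phi>(2) \<psi>(2) show ?thesis by (auto simp: marked_iso_def)
qed

lemma verts_gball: "verts (gball G x n) = {y \<in> verts G. gdist G x y \<le> n}"
  by (simp add: gball_def Let_def)

lemma adj_gball:
  "adj (gball G x n) u v \<longleftrightarrow> adj G u v \<and> u \<in> verts (gball G x n) \<and> v \<in> verts (gball G x n)"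
  by (auto simp: gball_def Let_def adj_def)

lemma gdist_le: "(adj G ^^ k) x y \<Longrightarrow> gdist G x y \<le> k"
  unfolding gdist_def by (rule Least_le)

lemma relpowp_gdist:
  assumes "lf_graph G" "x \<in> verts G" "y \<in> verts G"
  shows "(adj G ^^ gdist G x y) x y"
proof -
  have "\<exists>n. (adj G ^^ n) x y"
    using assms by (metis lf_graph_def connected_graph_def rtranclp_imp_relpowp)
  then show ?thesis unfolding gdist_def by (rule LeastI_ex)
qed

lemma gdist_self [simp]: "gdist G x x = 0"
  using gdist_le[of 0 G x x] by simp

lemma finite_gball:
  assumes "lf_graph G" "x \<in> verts G"
  shows "finite (verts (gball G x n))"
proof -
  have fin: "finite {y. (adj G ^^ k) x y} \<and> {y. (adj G ^^ k) x y} \<subseteq> verts G" for k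
  proof (induction k)
    case (Suc k)
    have "{y. (adj G ^^ Suc k) x y} = (\<Union>z\<in>{z. (adj G ^^ k) x z}. {y. adj G z y})"
      by auto
    moreover have "finite {y. adj G z y}" "{y. adj G z y} \<subseteq> verts G" if "z \<in> verts G" for z
      using assms that adj_verts[of G] by (auto simp: lf_graph_def locally_finite_def)
    ultimately show ?case using Suc by (smt (verit) UN_least finite_UN_I subsetD)
  qed (use assms in auto)
  have "verts (gball G x n) \<subseteq> (\<Union>k\<le>n. {y. (adj G ^^ k) x y})"
    using relpowp_gdist[OF assms] by (auto simp: verts_gball)
  then show ?thesis by (rule finite_subset) (use fin in auto)
qed

lemma gball_iso_path:
  assumes iso: "graph_iso \<phi> (gball G x m) (gball H y m)" and xy: "\<phi> x = y"
    and G: "lf_graph G" "x \<in> verts G"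
    and path: "(adj G ^^ k) x u" and "k \<le> m"
  shows "u \<in> verts (gball G x m) \<and> (adj H ^^ k) y (\<phi> u)"
  using path \<open>k \<le> m\<close>
proof (induction k arbitrary: u)
  case 0
  then show ?case using xy G by (auto simp: verts_gball)
next
  case (Suc k)
  then obtain v where v: "(adj G ^^ k) x v" "adj G v u" by auto
  with Suc have IH: "v \<in> verts (gball G x m)" "(adj H ^^ k) y (\<phi> v)" by auto
  have u: "u \<in> verts (gball G x m)"
    using G v adj_verts[of G v u] gdist_le[OF Suc.prems(1)] Suc.prems(2)
    by (auto simp: verts_gball lf_graph_def)
  with v IH have "adj (gball G x m) v u" by (simp add: adj_gball)
  with iso IH u have "adj (gball H y m) (\<phi> v) (\<phi> u)" by (auto simp: graph_iso_def)
  with IH u show ?case by (auto simp: adj_gball)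
qed

lemma gball_iso_gdist_le:
  assumes iso: "graph_iso \<phi> (gball G x m) (gball H y m)" and xy: "\<phi> x = y"
    and G: "lf_graph G" "x \<in> verts G" and u: "u \<in> verts (gball G x m)"
  shows "gdist H y (\<phi> u) \<le> gdist G x u"
proof -
  have "(adj G ^^ gdist G x u) x u" "gdist G x u \<le> m"
    using u relpowp_gdist[OF G] by (auto simp: verts_gball)
  from gball_iso_path[OF iso xy G this] show ?thesis by (auto intro: gdist_le)
qed

lemma gball_iso_gdist:
  assumes iso: "graph_iso \<phi> (gball G x m) (gball H y m)" and xy: "\<phi> x = y"
    and G: "lf_graph G" "x \<in> verts G" and H: "lf_graph H" "y \<in> verts H"
    and u: "u \<in> verts (gball G x m)"
  shows "gdist H y (\<phi> u) = gdist G x u"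
proof (rule antisym)
  let ?\<psi> = "inv_into (verts (gball G x m)) \<phi>"
  have b: "bij_betw \<phi> (verts (gball G x m)) (verts (gball H y m))"
    using iso by (simp add: graph_iso_def)
  have x: "x \<in> verts (gball G x m)" using G by (simp add: verts_gball)
  have inv: "?\<psi> y = x" "?\<psi> (\<phi> u) = u"
    using b x u xy by (auto simp: bij_betw_def)
  have "\<phi> u \<in> verts (gball H y m)" using b u by (auto simp: bij_betw_def)
  from gball_iso_gdist_le[OF graph_iso_inv[OF iso] inv(1) H this] inv(2)
  show "gdist G x u \<le> gdist H y (\<phi> u)" by simp
qed (rule gball_iso_gdist_le[OF iso xy G u])

lemma gball_iso_restrict:
  assumes iso: "graph_iso \<phi> (gball G x m) (gball H y m)" and xy: "\<phi> x = y"
    and G: "lf_graph G" "x \<in> verts G" and H: "lf_graph H" "y \<in> verts H" and "n \<le> m"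
  shows "graph_iso \<phi> (gball G x n) (gball H y n)"
proof -
  have b: "bij_betw \<phi> (verts (gball G x m)) (verts (gball H y m))"
    using iso by (simp add: graph_iso_def)
  note d = gball_iso_gdist[OF iso xy G H]
  have sub: "verts (gball G x n) \<subseteq> verts (gball G x m)"
    using \<open>n \<le> m\<close> by (auto simp: verts_gball)
  have im: "\<phi> ` verts (gball G x n) = verts (gball H y n)"
  proof (rule set_eqI, rule iffI)
    fix v assume "v \<in> \<phi> ` verts (gball G x n)"
    then obtain u where u: "u \<in> verts (gball G x n)" "v = \<phi> u" by auto
    then have "v \<in> verts (gball H y m)" using b sub by (auto simp: bij_betw_def)
    with u d[of u] sub show "v \<in> verts (gball H y n)" by (auto simp: verts_gball)
  next
    fix v assume v: "v \<in> verts (gball H y n)"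
    then have "v \<in> verts (gball H y m)" using \<open>n \<le> m\<close> by (auto simp: verts_gball)
    then obtain u where u: "u \<in> verts (gball G x m)" "v = \<phi> u" using b by (auto simp: bij_betw_def)
    with v d[of u] show "v \<in> \<phi> ` verts (gball G x n)" by (auto simp: verts_gball)
  qed
  have "bij_betw \<phi> (verts (gball G x n)) (verts (gball H y n))"
    using b sub im by (auto simp: bij_betw_def intro: inj_on_subset)
  moreover have "adj (gball G x n) u v \<longleftrightarrow> adj (gball H y n) (\<phi> u) (\<phi> v)"
    if "u \<in> verts (gball G x n)" "v \<in> verts (gball G x n)" for u v
  proof -
    have "adj (gball G x m) u v \<longleftrightarrow> adj (gball H y m) (\<phi> u) (\<phi> v)"
      using iso sub that by (auto simp: graph_iso_def)
    moreover have "\<phi> u \<in> verts (gball H y n)" "\<phi> v \<in> verts (gball H y n)"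
      using im that by auto
    moreover have "\<phi> u \<in> verts (gball H y m)" "\<phi> v \<in> verts (gball H y m)"
      using b sub that by (auto simp: bij_betw_def)
    ultimately show ?thesis using that sub by (auto simp: adj_gball)
  qed
  ultimately show ?thesis by (simp add: graph_iso_def)
qed

section \<open>The local metric\<close>

text \<open>
  The first vertex of each list is the root. Inserting \<open>1\<close> only matters for two distinguished
  vertices, where the set of radii may be empty; with the root alone, \<open>n = 0\<close> always qualifies
  (see \<open>dist_rooted_graph_Inf\<close> below).
\<close>

definition loc_iso :: "'v graph \<Rightarrow> 'v list \<Rightarrow> 'w graph \<Rightarrow> 'w list \<Rightarrow> nat \<Rightarrow> bool" where
  "loc_iso G xs H ys n \<longleftrightarrow> marked_iso (gball G (hd xs) n) xs (gball H (hd ys) n) ys"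

definition loc_dist :: "'v graph \<Rightarrow> 'v list \<Rightarrow> 'w graph \<Rightarrow> 'w list \<Rightarrow> real" where
  "loc_dist G xs H ys = Inf (insert 1 {1 / (real n + 1) | n. loc_iso G xs H ys n})"

lemma loc_iso_refl:
  assumes "lf_graph G" "set xs \<subseteq> verts G" "xs \<noteq> []"
  shows "\<exists>n0. \<forall>n\<ge>n0. loc_iso G xs G xs n"
proof -
  have "set xs \<subseteq> verts (gball G (hd xs) n)" if "n \<ge> Max (gdist G (hd xs) ` set xs)" for n
  proof
    fix v assume v: "v \<in> set xs"
    then have "gdist G (hd xs) v \<le> Max (gdist G (hd xs) ` set xs)" by simp
    with v that assms show "v \<in> verts (gball G (hd xs) n)" by (auto simp: verts_gball)
  qed
  then show ?thesis unfolding loc_iso_def using marked_iso_refl by meson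
qed

lemma loc_iso_sym: "loc_iso G xs H ys n \<Longrightarrow> loc_iso H ys G xs n"
  unfolding loc_iso_def by (rule marked_iso_sym)

lemma loc_iso_set: "loc_iso G xs H ys n \<Longrightarrow>
    set xs \<subseteq> verts (gball G (hd xs) n) \<and> set ys \<subseteq> verts (gball H (hd ys) n)"
  using marked_iso_sym unfolding loc_iso_def marked_iso_def by metis

lemma loc_isoE:
  assumes "loc_iso G xs H ys n" "xs \<noteq> []"
  obtains \<phi> where "graph_iso \<phi> (gball G (hd xs) n) (gball H (hd ys) n)"
    "map \<phi> xs = ys" "\<phi> (hd xs) = hd ys"
  using assms by (auto simp: loc_iso_def marked_iso_def hd_map)

lemma loc_iso_restrict:
  assumes "loc_iso G xs H ys m" "n \<le> m" "set xs \<subseteq> verts (gball G (hd xs) n)"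
    and "lf_graph G" "lf_graph H" "xs \<noteq> []"
  shows "loc_iso G xs H ys n"
proof -
  obtain \<phi> where \<phi>: "graph_iso \<phi> (gball G (hd xs) m) (gball H (hd ys) m)"
    "map \<phi> xs = ys" "\<phi> (hd xs) = hd ys" using assms(1,6) by (rule loc_isoE)
  have "ys \<noteq> []" using \<phi>(2) assms(6) by auto
  then have "hd xs \<in> verts G" "hd ys \<in> verts H"
    using loc_iso_set[OF assms(1)] assms(6) by (auto simp: verts_gball dest: hd_in_set)
  then show ?thesis
    using gball_iso_restrict[OF \<phi>(1,3) assms(4) _ assms(5) _ assms(2)] \<phi> assms(3)
    by (auto simp: loc_iso_def marked_iso_def)
qed

lemma loc_iso_trans:
  assumes "loc_iso G xs H ys n" "loc_iso H ys K zs m"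
    and "lf_graph G" "lf_graph H" "lf_graph K" "xs \<noteq> []"
  shows "loc_iso G xs K zs (min n m)"
proof -
  have ys: "ys \<noteq> []" using assms(1,6) by (auto simp: loc_iso_def marked_iso_def)
  have zs: "zs \<noteq> []" using assms(2) ys by (auto simp: loc_iso_def marked_iso_def)
  show ?thesis
  proof (cases "n \<le> m")
    case True
    then have "loc_iso H ys K zs n"
      using loc_iso_restrict[OF assms(2) True] loc_iso_set[OF assms(1)] assms ys by auto
    with assms(1) True show ?thesis by (auto simp: loc_iso_def min_def intro: marked_iso_trans)
  next
    case False
    then have m: "m \<le> n" by simp
    have "loc_iso H ys G xs m"
      using loc_iso_restrict[OF loc_iso_sym[OF assms(1)] m] loc_iso_set[OF assms(2)] assms ys by auto
    then have "loc_iso G xs H ys m" by (rule loc_iso_sym)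
    with assms(2) m show ?thesis
      by (auto simp: loc_iso_def min_def dest: marked_iso_trans split: if_splits)
  qed
qed

lemma loc_dist_bdd: "bdd_below (insert (1::real) {1 / (real n + 1) | n. P n})"
  by (rule bdd_belowI[of _ 0]) auto

lemma loc_dist_nonneg: "0 \<le> loc_dist G xs H ys"
  unfolding loc_dist_def by (rule cInf_greatest) auto

lemma loc_dist_le1: "loc_dist G xs H ys \<le> 1"
  unfolding loc_dist_def by (rule cInf_lower[OF _ loc_dist_bdd]) auto

lemma loc_dist_le: "loc_iso G xs H ys n \<Longrightarrow> loc_dist G xs H ys \<le> 1 / (real n + 1)"
  unfolding loc_dist_def by (rule cInf_lower[OF _ loc_dist_bdd]) auto

lemma loc_dist_less:
  assumes "loc_dist G xs H ys < e" "e \<le> 1"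
  obtains n where "loc_iso G xs H ys n" "1 / (real n + 1) < e"
proof -
  have "\<exists>z\<in>insert 1 {1 / (real n + 1) | n. loc_iso G xs H ys n}. z < e"
    using assms cInf_less_iff[OF _ loc_dist_bdd] unfolding loc_dist_def by blast
  with that assms(2) show ?thesis by auto
qed

lemma loc_dist_sym: "loc_dist G xs H ys = loc_dist H ys G xs"
  unfolding loc_dist_def using loc_iso_sym by metis

lemma loc_dist_triangle:
  assumes "lf_graph G" "lf_graph H" "lf_graph K" "xs \<noteq> []"
  shows "loc_dist G xs K zs \<le> loc_dist G xs H ys + loc_dist H ys K zs"
proof -
  have "loc_dist G xs K zs \<le> max (loc_dist G xs H ys) (loc_dist H ys K zs)"
  proof (rule dense_ge)
    fix e assume e: "max (loc_dist G xs H ys) (loc_dist H ys K zs) < e"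
    show "loc_dist G xs K zs \<le> e"
    proof (cases "e \<le> 1")
      case True
      obtain n where n: "loc_iso G xs H ys n" "1 / (real n + 1) < e"
        using e True by (auto elim: loc_dist_less)
      obtain m where m: "loc_iso H ys K zs m" "1 / (real m + 1) < e"
        using e True by (auto elim: loc_dist_less)
      from loc_dist_le[OF loc_iso_trans[OF n(1) m(1) assms]] n(2) m(2)
      show ?thesis by (auto simp: min_def split: if_splits)
    next
      case False
      with loc_dist_le1[of G xs K zs] show ?thesis by linarith
    qed
  qed
  with loc_dist_nonneg[of G xs H ys] loc_dist_nonneg[of H ys K zs] show ?thesis by linarith
qed

lemma loc_dist_zeroD:
  assumes "loc_dist G xs H ys = 0"
  shows "\<exists>n\<ge>N. loc_iso G xs H ys n"
proof -
  obtain n where n: "loc_iso G xs H ys n" "1 / (real n + 1) < 1 / (real N + 1)"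
    by (rule loc_dist_less[of G xs H ys "1 / (real N + 1)"]) (auto simp: assms)
  then have "N \<le> n" by (simp add: field_simps)
  with n(1) show ?thesis by blast
qed

lemma loc_dist_zeroI:
  assumes "\<forall>n\<ge>n0. loc_iso G xs H ys n"
  shows "loc_dist G xs H ys = 0"
proof (rule antisym[OF _ loc_dist_nonneg], rule dense_ge)
  fix e :: real assume "0 < e"
  then obtain n where "1 / (real n + 1) < e"
    using nat_approx_posE by (metis of_nat_Suc add.commute)
  moreover have "1 / (real (max n n0) + 1) \<le> 1 / (real n + 1)" by (simp add: frac_le)
  moreover have "loc_dist G xs H ys \<le> 1 / (real (max n n0) + 1)"
    using assms by (intro loc_dist_le) auto
  ultimately show "loc_dist G xs H ys \<le> e" by linarith
qed

lemma graph_iso_gball: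
  assumes iso: "graph_iso \<phi> G H" and G: "lf_graph G" "x \<in> verts G" and H: "lf_graph H"
  shows "graph_iso \<phi> (gball G x n) (gball H (\<phi> x) n)"
proof -
  have b: "bij_betw \<phi> (verts G) (verts H)" using iso by (simp add: graph_iso_def)
  have path: "(adj B ^^ k) (\<psi> z) (\<psi> u)"
    if "graph_iso \<psi> A B" "simple_graph A" "(adj A ^^ k) z u"
    for A :: "'c graph" and B :: "'d graph" and \<psi> k z u
    using that(3)
  proof (induction k arbitrary: u)
    case (Suc k)
    then obtain v where v: "(adj A ^^ k) z v" "adj A v u" by auto
    with that Suc.IH[OF v(1)] adj_verts[OF that(2) v(2)] show ?case
      by (auto simp: graph_iso_def)
  qed auto
  have sG: "simple_graph G" and sH: "simple_graph H" using G H by (auto simp: lf_graph_def)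
  have x: "\<phi> x \<in> verts H" using b G by (auto simp: bij_betw_def)
  have d: "gdist H (\<phi> x) (\<phi> u) = gdist G x u" if u: "u \<in> verts G" for u
  proof (rule antisym)
    show "gdist H (\<phi> x) (\<phi> u) \<le> gdist G x u"
      using path[OF iso sG relpowp_gdist[OF G u]] by (rule gdist_le)
    have "\<phi> u \<in> verts H" using b u by (auto simp: bij_betw_def)
    from path[OF graph_iso_inv[OF iso] sH relpowp_gdist[OF H x this]]
    show "gdist G x u \<le> gdist H (\<phi> x) (\<phi> u)"
      using b u G(2) by (intro gdist_le) (auto simp: bij_betw_def)
  qed
  have "\<phi> ` verts (gball G x n) = verts (gball H (\<phi> x) n)"
    using b d by (force simp: verts_gball bij_betw_def)
  moreover have "inj_on \<phi> (verts (gball G x n))"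
    using b by (auto simp: verts_gball bij_betw_def intro: inj_on_subset)
  moreover have "adj (gball G x n) u v \<longleftrightarrow> adj (gball H (\<phi> x) n) (\<phi> u) (\<phi> v)"
    if "u \<in> verts (gball G x n)" "v \<in> verts (gball G x n)" for u v
    using iso that calculation(1) by (auto simp: adj_gball graph_iso_def verts_gball)
  ultimately show ?thesis by (auto simp: graph_iso_def bij_betw_def)
qed

lemma marked_iso_imp_loc_dist:
  assumes "marked_iso G xs H ys" "lf_graph G" "lf_graph H" "xs \<noteq> []"
  shows "loc_dist G xs H ys = 0"
proof -
  obtain \<phi> where xs: "set xs \<subseteq> verts G" and \<phi>: "graph_iso \<phi> G H" "map \<phi> xs = ys"
    using assms(1) by (auto simp: marked_iso_def)
  have hd: "hd xs \<in> verts G" "\<phi> (hd xs) = hd ys"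
    using xs assms(4) \<phi>(2) by (auto simp: hd_map)
  obtain n0 where "\<forall>n\<ge>n0. loc_iso G xs G xs n"
    using loc_iso_refl[OF assms(2) xs assms(4)] by blast
  then have "\<forall>n\<ge>n0. loc_iso G xs H ys n"
    using graph_iso_gball[OF \<phi>(1) assms(2) hd(1) assms(3)] \<phi>(2) hd(2) loc_iso_set
    by (auto simp: loc_iso_def marked_iso_def)
  then show ?thesis by (rule loc_dist_zeroI)
qed

text \<open>Compactness: graphs all of whose balls are isomorphic are isomorphic.\<close>

lemma loc_dist_imp_marked_iso:
  fixes G :: "nat graph" and H :: "nat graph"
  assumes G: "lf_graph G" and H: "lf_graph H" and xs: "set xs \<subseteq> verts G" "xs \<noteq> []"
    and d0: "loc_dist G xs H ys = 0"
  shows "marked_iso G xs H ys"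
proof -
  define x y where "x = hd xs" and "y = hd ys"
  have "\<exists>\<phi> n. n \<ge> N \<and> graph_iso \<phi> (gball G x n) (gball H y n) \<and> map \<phi> xs = ys \<and> \<phi> x = y" for N
    using loc_dist_zeroD[OF d0, of N] loc_isoE[OF _ xs(2)] unfolding x_def y_def by metis
  then obtain \<Phi> R where R: "\<And>N. R N \<ge> N"
    and iso: "\<And>N. graph_iso (\<Phi> N) (gball G x (R N)) (gball H y (R N))"
    and mk: "\<And>N. map (\<Phi> N) xs = ys" and root: "\<And>N. \<Phi> N x = y" by metis
  have x: "x \<in> verts G" using xs by (auto simp: x_def)
  then have "\<Phi> 0 x \<in> verts (gball H y (R 0))"
    using iso[of 0] by (auto simp: graph_iso_def bij_betw_def verts_gball)
  then have y: "y \<in> verts H" by (simp add: root verts_gball)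
  have inb: "\<Phi> N v \<in> verts (gball H y (gdist G x v))"
    if "v \<in> verts G" "gdist G x v \<le> N" for v N
  proof -
    have v: "v \<in> verts (gball G x (R N))" using that R[of N] by (simp add: verts_gball)
    then have "\<Phi> N v \<in> verts (gball H y (R N))"
      using iso[of N] by (auto simp: graph_iso_def bij_betw_def)
    with gball_iso_gdist[OF iso root G x H y v] show ?thesis by (simp add: verts_gball)
  qed
  define P where "P v s \<longleftrightarrow> (v \<in> verts G \<longrightarrow> (\<exists>c K. \<forall>k\<ge>K. \<Phi> (s k) v = c))" for v and s :: "nat \<Rightarrow> nat"
  interpret subseqs P
  proof
    fix v and s :: "nat \<Rightarrow> nat" assume s: "strict_mono s"
    show "\<exists>r. strict_mono r \<and> P v (s \<circ> r)"
    proof (cases "v \<in> verts G")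
      case False
      then show ?thesis by (auto simp: P_def intro!: exI[of _ id] strict_mono_id)
    next
      case True
      let ?A = "{gdist G x v..}" and ?f = "\<lambda>k. \<Phi> (s k) v"
      have "?f ` ?A \<subseteq> verts (gball H y (gdist G x v))"
      proof
        fix w assume "w \<in> ?f ` ?A"
        then obtain k where k: "gdist G x v \<le> k" "w = \<Phi> (s k) v" by auto
        moreover have "k \<le> s k" using s by (rule strict_mono_imp_increasing)
        ultimately show "w \<in> verts (gball H y (gdist G x v))" using inb[OF True] by auto
      qed
      then have "finite (?f ` ?A)" by (rule finite_subset) (rule finite_gball[OF H y])
      from pigeonhole_infinite[OF infinite_Ici this]
      obtain a where inf: "infinite {k \<in> ?A. ?f k = ?f a}" by auto
      have "strict_mono (enumerate {k \<in> ?A. ?f k = ?f a})"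
        using inf by (rule strict_mono_enumerate)
      moreover have "P v (s \<circ> enumerate {k \<in> ?A. ?f k = ?f a})"
        unfolding P_def using enumerate_in_set[OF inf] by auto
      ultimately show ?thesis by blast
    qed
  qed
  have "P v (diagseq \<circ> ((+) (Suc v)))" for v
  proof (rule diagseq_holds)
    fix r s :: "nat \<Rightarrow> nat" and n assume r: "strict_mono r" and "P n s"
    moreover have "k \<le> r k" for k using r by (rule strict_mono_imp_increasing)
    ultimately show "P n (s \<circ> r)" unfolding P_def o_def by (meson order_trans)
  qed
  then have diag: "\<exists>c K. \<forall>k\<ge>K. \<Phi> (diagseq (Suc v + k)) v = c" if "v \<in> verts G" for v
    using that by (simp add: P_def)
  have "\<exists>c K. \<forall>k\<ge>K. \<Phi> (diagseq k) v = c" if v: "v \<in> verts G" for v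
  proof -
    obtain c K where c: "\<And>k. k \<ge> K \<Longrightarrow> \<Phi> (diagseq (Suc v + k)) v = c" using diag[OF v] by blast
    have "\<Phi> (diagseq k) v = c" if "k \<ge> Suc v + K" for k
      using c[of "k - Suc v"] that by simp
    then show ?thesis by blast
  qed
  then obtain \<phi> K where \<phi>: "\<And>v k. v \<in> verts G \<Longrightarrow> k \<ge> K v \<Longrightarrow> \<Phi> (diagseq k) v = \<phi> v"
    by metis
  have dk: "k \<le> R (diagseq k)" for k
    using strict_mono_imp_increasing[OF subseq_diagseq, of k] R[of "diagseq k"] by linarith
  have agree: "\<exists>k\<ge>N. \<forall>v\<in>A. v \<in> verts (gball G x (R (diagseq k))) \<and> \<Phi> (diagseq k) v = \<phi> v"
    if A: "finite A" "A \<subseteq> verts G" for A N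
  proof -
    define k where "k = N + (\<Sum>v\<in>A. K v + gdist G x v)"
    have le: "K v + gdist G x v \<le> k" if "v \<in> A" for v
      unfolding k_def using member_le_sum[of v A "\<lambda>v. K v + gdist G x v"] that A(1) by simp
    have "v \<in> verts (gball G x (R (diagseq k))) \<and> \<Phi> (diagseq k) v = \<phi> v" if "v \<in> A" for v
      using le[OF that] dk[of k] \<phi>[of v k] A that by (auto simp: verts_gball)
    then show ?thesis by (intro exI[of _ k]) (auto simp: k_def)
  qed
  have img: "\<phi> v \<in> verts H" if v: "v \<in> verts G" for v
  proof -
    obtain k where "v \<in> verts (gball G x (R (diagseq k)))" "\<Phi> (diagseq k) v = \<phi> v"
      using agree[of "{v}" 0] v by auto
    with iso[of "diagseq k"] have "\<phi> v \<in> verts (gball H y (R (diagseq k)))"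
      by (metis graph_iso_def bij_betwE)
    then show ?thesis by (simp add: verts_gball)
  qed
  have pres: "(u = v \<longleftrightarrow> \<phi> u = \<phi> v) \<and> (adj G u v \<longleftrightarrow> adj H (\<phi> u) (\<phi> v))"
    if uv: "u \<in> verts G" "v \<in> verts G" for u v
  proof -
    obtain k where k: "\<forall>w\<in>{u, v}. w \<in> verts (gball G x (R (diagseq k))) \<and> \<Phi> (diagseq k) w = \<phi> w"
      using agree[of "{u, v}" 0] uv by auto
    let ?f = "\<Phi> (diagseq k)" and ?n = "R (diagseq k)"
    have b: "bij_betw ?f (verts (gball G x ?n)) (verts (gball H y ?n))"
      and "adj (gball G x ?n) u v \<longleftrightarrow> adj (gball H y ?n) (?f u) (?f v)"
      using iso[of "diagseq k"] k by (auto simp: graph_iso_def)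
    moreover have "?f u \<in> verts (gball H y ?n)" "?f v \<in> verts (gball H y ?n)"
      using bij_betwE[OF b] k by blast+
    moreover have "u = v \<longleftrightarrow> ?f u = ?f v" using inj_on_eq_iff[OF bij_betw_imp_inj_on[OF b], of u v] k by auto
    ultimately show ?thesis using k by (auto simp: adj_gball)
  qed
  have surj: "w \<in> \<phi> ` verts G" if w: "w \<in> verts H" for w
  proof -
    let ?B = "verts (gball G x (gdist H y w))"
    obtain k where k: "k \<ge> gdist H y w"
      "\<forall>v\<in>?B. v \<in> verts (gball G x (R (diagseq k))) \<and> \<Phi> (diagseq k) v = \<phi> v"
      using agree[OF finite_gball[OF G x], of "gdist H y w" "gdist H y w"]
      by (metis (no_types, lifting) mem_Collect_eq subsetI verts_gball)
    have "w \<in> verts (gball H y (R (diagseq k)))"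
      using w k(1) dk[of k] by (simp add: verts_gball)
    then obtain v where v: "v \<in> verts (gball G x (R (diagseq k)))" "w = \<Phi> (diagseq k) v"
      using iso[of "diagseq k"] unfolding graph_iso_def bij_betw_def by blast
    with gball_iso_gdist[OF iso root G x H y v(1)] have "v \<in> ?B" by (auto simp: verts_gball)
    with k(2) v(2) have "w = \<phi> v" by auto
    with v(1) show ?thesis by (auto simp: verts_gball)
  qed
  have "graph_iso \<phi> G H"
    unfolding graph_iso_def bij_betw_def
  proof (intro conjI ballI)
    show "inj_on \<phi> (verts G)" using pres by (simp add: inj_on_def)
    show "\<phi> ` verts G = verts H" using img surj by auto
    show "adj G u v \<longleftrightarrow> adj H (\<phi> u) (\<phi> v)" if "u \<in> verts G" "v \<in> verts G" for u v
      using pres[OF that] by (rule conjunct2)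
  qed
  moreover have "map \<phi> xs = ys"
  proof -
    obtain k where "\<forall>v\<in>set xs. \<Phi> (diagseq k) v = \<phi> v" using agree[of "set xs" 0] xs by auto
    then have "map \<phi> xs = map (\<Phi> (diagseq k)) xs" by simp
    with mk show ?thesis by simp
  qed
  ultimately show ?thesis using xs by (auto simp: marked_iso_def)
qed

section \<open>Spaces of isomorphism classes\<close>

text \<open>
  As vertex sets are countable, every isomorphism class has a representative whose vertices are
  natural numbers.
\<close>

definition rooted_iso :: "nat graph \<times> nat \<Rightarrow> nat graph \<times> nat \<Rightarrow> bool" where
  "rooted_iso = (\<lambda>(G, x) (H, y). lf_graph G \<and> lf_graph H \<and> marked_iso G [x] H [y])"

definition birooted_iso :: "nat graph \<times> nat \<times> nat \<Rightarrow> nat graph \<times> nat \<times> nat \<Rightarrow> bool" where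
  "birooted_iso =
     (\<lambda>(G, x, x') (H, y, y'). lf_graph G \<and> lf_graph H \<and> marked_iso G [x, x'] H [y, y'])"

lemma lf_graph_singleton: "lf_graph (Graph {x} {})"
  by (simp add: lf_graph_def simple_graph_def locally_finite_def connected_graph_def adj_def)

quotient_type rooted_graph = "nat graph \<times> nat" / partial: rooted_iso
proof (rule part_equivpI)
  show "\<exists>x. rooted_iso x x"
    by (rule exI[of _ "(Graph {0} {}, 0)"])
       (simp add: rooted_iso_def lf_graph_singleton marked_iso_refl)
qed (auto simp: rooted_iso_def symp_def transp_def intro: marked_iso_sym marked_iso_trans)

quotient_type birooted_graph = "nat graph \<times> nat \<times> nat" / partial: birooted_iso
proof (rule part_equivpI)
  show "\<exists>x. birooted_iso x x"
    by (rule exI[of _ "(Graph {0} {}, 0, 0)"])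
       (simp add: birooted_iso_def lf_graph_singleton marked_iso_refl)
qed (auto simp: birooted_iso_def symp_def transp_def intro: marked_iso_sym marked_iso_trans)

text \<open>
  An arbitrary representative of the class; everything evaluated on it below is invariant under
  isomorphism.
\<close>

definition graph_of :: "rooted_graph \<Rightarrow> nat graph" where
  "graph_of g = fst (rep_rooted_graph g)"

definition root_of :: "rooted_graph \<Rightarrow> nat" where
  "root_of g = snd (rep_rooted_graph g)"

lemma rooted_graph_rep:
  "rooted_iso (graph_of g, root_of g) (graph_of g, root_of g)"
  "abs_rooted_graph (graph_of g, root_of g) = g"
  using Quotient_rep_reflp[OF Quotient_rooted_graph] Quotient_abs_rep[OF Quotient_rooted_graph]
  by (auto simp: graph_of_def root_of_def)

instantiation rooted_graph :: metric_space
begin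

definition dist_rooted_graph :: "rooted_graph \<Rightarrow> rooted_graph \<Rightarrow> real" where
  "dist_rooted_graph g h = loc_dist (graph_of g) [root_of g] (graph_of h) [root_of h]"

definition uniformity_rooted_graph :: "(rooted_graph \<times> rooted_graph) filter" where
  "uniformity_rooted_graph = (INF e\<in>{0 <..}. principal {(x, y). dist x y < e})"

definition open_rooted_graph :: "rooted_graph set \<Rightarrow> bool" where
  "open_rooted_graph U \<longleftrightarrow> (\<forall>x\<in>U. eventually (\<lambda>(x', y). x' = x \<longrightarrow> y \<in> U) uniformity)"

instance
proof
  fix f g h :: rooted_graph
  have rep: "lf_graph (graph_of k)" "root_of k \<in> verts (graph_of k)" for k
    using rooted_graph_rep(1)[of k] by (auto simp: rooted_iso_def marked_iso_def)
  show "dist f g = 0 \<longleftrightarrow> f = g"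
  proof
    assume "dist f g = 0"
    then have "marked_iso (graph_of f) [root_of f] (graph_of g) [root_of g]"
      using rep by (intro loc_dist_imp_marked_iso) (auto simp: dist_rooted_graph_def)
    then have "rooted_iso (graph_of f, root_of f) (graph_of g, root_of g)"
      using rep by (simp add: rooted_iso_def)
    from Quotient_rel_abs[OF Quotient_rooted_graph this] show "f = g"
      by (simp add: rooted_graph_rep)
  next
    assume "f = g"
    with rep show "dist f g = 0"
      unfolding dist_rooted_graph_def by (auto intro!: marked_iso_imp_loc_dist marked_iso_refl)
  qed
  show "dist f g \<le> dist f h + dist g h"
    using loc_dist_triangle[OF rep(1)[of f] rep(1)[of h] rep(1)[of g]] loc_dist_sym
    unfolding dist_rooted_graph_def by (metis list.discI)
qed (simp_all only: uniformity_rooted_graph_def open_rooted_graph_def)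

end

lemma dist_rooted_graph_Inf:
  "dist g h = Inf {1 / (real n + 1) | n.
     marked_iso (gball (graph_of g) (root_of g) n) [root_of g]
                (gball (graph_of h) (root_of h) n) [root_of h]}"
proof -
  have rep: "lf_graph (graph_of k)" "root_of k \<in> verts (graph_of k)" for k
    using rooted_graph_rep(1)[of k] by (auto simp: rooted_iso_def marked_iso_def)
  have b0: "verts (gball (graph_of k) (root_of k) 0) = {root_of k}" for k
    using rep[of k] relpowp_gdist[OF rep[of k]] by (fastforce simp: verts_gball)
  have na: "\<not> adj (graph_of k) v v" for k v
    using rep(1)[of k] by (auto simp: lf_graph_def simple_graph_def adj_def)
  have "marked_iso (gball (graph_of g) (root_of g) 0) [root_of g]
                   (gball (graph_of h) (root_of h) 0) [root_of h]"
    unfolding marked_iso_def graph_iso_def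
    by (auto simp: b0 adj_gball na bij_betw_def intro!: exI[of _ "\<lambda>_. root_of h"])
  then have "1 \<in> {1 / (real n + 1) | n.
     marked_iso (gball (graph_of g) (root_of g) n) [root_of g]
                (gball (graph_of h) (root_of h) n) [root_of h]}"
    by (intro CollectI exI[of _ 0]) auto
  then show ?thesis by (simp add: dist_rooted_graph_def loc_dist_def loc_iso_def insert_absorb)
qed

instantiation birooted_graph :: metric_space
begin

definition dist_birooted_graph :: "birooted_graph \<Rightarrow> birooted_graph \<Rightarrow> real" where
  "dist_birooted_graph g h =
     (case (rep_birooted_graph g, rep_birooted_graph h) of
       ((G, x, x'), (H, y, y')) \<Rightarrow> loc_dist G [x, x'] H [y, y'])"

definition uniformity_birooted_graph :: "(birooted_graph \<times> birooted_graph) filter" where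
  "uniformity_birooted_graph = (INF e\<in>{0 <..}. principal {(x, y). dist x y < e})"

definition open_birooted_graph :: "birooted_graph set \<Rightarrow> bool" where
  "open_birooted_graph U \<longleftrightarrow> (\<forall>x\<in>U. eventually (\<lambda>(x', y). x' = x \<longrightarrow> y \<in> U) uniformity)"

instance
proof
  fix f g h :: birooted_graph
  define G x x' where "G k = fst (rep_birooted_graph k)"
    and "x k = fst (snd (rep_birooted_graph k))"
    and "x' k = snd (snd (rep_birooted_graph k))" for k
  have eq: "rep_birooted_graph k = (G k, x k, x' k)" for k by (simp add: G_def x_def x'_def)
  have rep: "lf_graph (G k)" "x k \<in> verts (G k)" "x' k \<in> verts (G k)" for k
    using Quotient_rep_reflp[OF Quotient_birooted_graph, of k]
    by (auto simp: eq birooted_iso_def marked_iso_def)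
  have dist: "dist k l = loc_dist (G k) [x k, x' k] (G l) [x l, x' l]" for k l
    by (simp add: dist_birooted_graph_def eq)
  have abs: "abs_birooted_graph (G k, x k, x' k) = k" for k
    using Quotient_abs_rep[OF Quotient_birooted_graph, of k] by (simp add: eq)
  show "dist f g = 0 \<longleftrightarrow> f = g"
  proof
    assume "dist f g = 0"
    then have "marked_iso (G f) [x f, x' f] (G g) [x g, x' g]"
      using rep by (intro loc_dist_imp_marked_iso) (auto simp: dist)
    then have "birooted_iso (G f, x f, x' f) (G g, x g, x' g)"
      using rep by (simp add: birooted_iso_def)
    from Quotient_rel_abs[OF Quotient_birooted_graph this] show "f = g" by (simp add: abs)
  next
    assume "f = g"
    with rep show "dist f g = 0"
      unfolding dist by (auto intro!: marked_iso_imp_loc_dist marked_iso_refl)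
  qed
  show "dist f g \<le> dist f h + dist g h"
    using loc_dist_triangle[OF rep(1)[of f] rep(1)[of h] rep(1)[of g]] loc_dist_sym
    unfolding dist by (metis list.discI)
qed (simp_all only: uniformity_birooted_graph_def open_birooted_graph_def)

end

section \<open>Unimodularity\<close>

definition unimodular :: "'w measure \<Rightarrow> ('w \<Rightarrow> rooted_graph) \<Rightarrow> bool" where
  "unimodular M X \<longleftrightarrow>
     (\<forall>f :: birooted_graph \<Rightarrow> ennreal. f \<in> borel_measurable borel \<longrightarrow>
        (\<integral>\<^sup>+\<omega>. (\<integral>\<^sup>+v. f (abs_birooted_graph (graph_of (X \<omega>), root_of (X \<omega>), v))
                  \<partial>count_space (verts (graph_of (X \<omega>)))) \<partial>M) =
        (\<integral>\<^sup>+\<omega>. (\<integral>\<^sup>+u. f (abs_birooted_graph (graph_of (X \<omega>), u, root_of (X \<omega>)))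
                  \<partial>count_space (verts (graph_of (X \<omega>)))) \<partial>M))"

section \<open>Simple random walk and collisions\<close>

definition trans_fun :: "'v graph \<Rightarrow> 'v \<Rightarrow> 'v \<Rightarrow> real" where
  "trans_fun G x y = (if adj G x y then 1 / real (vertex_degree G x) else 0)"

text \<open>The sum runs over the neighbours of \<open>x\<close>, outside which \<open>trans_fun G x\<close> vanishes.\<close>

primrec trans_fun_n :: "'v graph \<Rightarrow> nat \<Rightarrow> 'v \<Rightarrow> 'v \<Rightarrow> real" where
  "trans_fun_n G 0 x y = (if x = y then 1 else 0)"
| "trans_fun_n G (Suc n) x y = (\<Sum>z | adj G x z. trans_fun G x z * trans_fun_n G n z y)"

text \<open>
  \<open>discrete_srw G x M X\<close>: on the probability space \<open>M\<close>, the process \<open>X\<close> is a Markov chain with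
  transition function \<open>trans_fun G\<close> started from \<open>x\<close>. The graph with a single vertex has no simple
  random walk, since its transition function is identically zero.
\<close>

definition discrete_srw :: "'v graph \<Rightarrow> 'v \<Rightarrow> 'w measure \<Rightarrow> (nat \<Rightarrow> 'w \<Rightarrow> 'v) \<Rightarrow> bool" where
  "discrete_srw G x M X \<longleftrightarrow>
     prob_space M \<and> (\<forall>n. X n \<in> M \<rightarrow>\<^sub>M count_space UNIV) \<and> (AE \<omega> in M. X 0 \<omega> = x) \<and>
     (\<forall>n s y. measure M {\<omega> \<in> space M. (\<forall>i\<le>n. X i \<omega> = s i) \<and> X (Suc n) \<omega> = y} =
              measure M {\<omega> \<in> space M. \<forall>i\<le>n. X i \<omega> = s i} * trans_fun G (s n) y)"

text \<open>The law of the walk on path space. Two independent walks are the coordinates of the square of this law.\<close>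

definition srw_law :: "'v graph \<Rightarrow> 'v \<Rightarrow> (nat \<Rightarrow> 'v) measure \<Rightarrow> bool" where
  "srw_law G x \<mu> \<longleftrightarrow> sets \<mu> = sets (\<Pi>\<^sub>M n\<in>UNIV. count_space UNIV) \<and> discrete_srw G x \<mu> (\<lambda>n Z. Z n)"

lemma srw_law_exists:
  fixes G :: "'v::countable graph"
  assumes G: "lf_graph G" and deg: "\<And>v. v \<in> verts G \<Longrightarrow> vertex_degree G v > 0" and x: "x \<in> verts G"
  shows "\<exists>\<mu>. srw_law G x \<mu>"
proof -
  define step where "step v = pmf_of_set {y. adj G v y}" for v
  have step: "pmf (step v) y = trans_fun G v y" if "v \<in> verts G" for v y
  proof -
    have "finite {y. adj G v y}" "{y. adj G v y} \<noteq> {}"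
      using G deg[OF that] that by (auto simp: lf_graph_def locally_finite_def vertex_degree_def card_gt_0_iff)
    then show ?thesis by (simp add: step_def trans_fun_def vertex_degree_def)
  qed
  define D where "D = (\<Pi>\<^sub>M (n::nat, v)\<in>UNIV. measure_pmf (step v))"
  interpret D: product_prob_space "\<lambda>(n::nat, v). measure_pmf (step v)" UNIV
    by (intro product_prob_spaceI) (auto intro: measure_pmf.prob_space_axioms)
  have prob_D: "prob_space D" unfolding D_def by (rule D.P.prob_space_axioms)
  define W where "W n \<omega> = rec_nat x (\<lambda>n v. \<omega> (n, v)) n" for n and \<omega> :: "nat \<times> 'v \<Rightarrow> 'v"
  have W_simps [simp]: "W 0 \<omega> = x" "W (Suc n) \<omega> = \<omega> (n, W n \<omega>)" for n \<omega>
    by (simp_all add: W_def)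
  have comp: "(\<lambda>\<omega>. \<omega> (n, v)) \<in> D \<rightarrow>\<^sub>M count_space UNIV" for n v
    unfolding D_def
    using measurable_component_singleton[of "(n, v)" UNIV "\<lambda>(n::nat, v). measure_pmf (step v)"]
    by simp
  have W_meas [measurable]: "W n \<in> D \<rightarrow>\<^sub>M count_space UNIV" for n
  proof (induction n)
    case 0
    have "W 0 = (\<lambda>_. x)" by auto
    then show ?case by simp
  next
    case (Suc n)
    have "(\<lambda>\<omega>. (\<lambda>v. \<lambda>\<omega>. \<omega> (n, v)) (W n \<omega>) \<omega>) \<in> D \<rightarrow>\<^sub>M count_space UNIV"
      by (rule measurable_compose_countable[OF comp Suc])
    moreover have "W (Suc n) = (\<lambda>\<omega>. \<omega> (n, W n \<omega>))" by auto
    ultimately show ?case by simp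
  qed
  have path: "measure D {\<omega> \<in> space D. \<forall>i\<le>n. W i \<omega> = s i} =
      (if s 0 = x then \<Prod>i<n. pmf (step (s i)) (s (Suc i)) else 0)" for n s
  proof (cases "s 0 = x")
    case True
    let ?J = "(\<lambda>i. (i, s i)) ` {..<n}"
    have inj: "inj_on (\<lambda>i. (i, s i)) {..<n}" by (auto simp: inj_on_def)
    have iff: "(\<forall>i\<le>n. W i \<omega> = s i) \<longleftrightarrow> (\<forall>i<n. \<omega> (i, s i) = s (Suc i))" for \<omega>
    proof (induction n)
      case (Suc n)
      then show ?case using less_Suc_eq le_Suc_eq by (metis W_simps(2) order_refl)
    qed (use True in auto)
    have "{\<omega> \<in> space D. \<forall>i\<le>n. W i \<omega> = s i} =
        prod_emb UNIV (\<lambda>(n::nat, v). measure_pmf (step v)) ?J (\<Pi>\<^sub>E j\<in>?J. {s (Suc (fst j))})"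
      unfolding iff by (auto simp: prod_emb_def D_def space_PiM Pi_iff PiE_iff)
    also have "measure D \<dots> =
        (\<Prod>j\<in>?J. measure (case j of (n, v) \<Rightarrow> measure_pmf (step v)) {s (Suc (fst j))})"
      unfolding D_def by (rule D.measure_PiM_emb) auto
    also have "\<dots> = (\<Prod>i<n. pmf (step (s i)) (s (Suc i)))"
      by (subst prod.reindex[OF inj]) (simp add: pmf.rep_eq)
    finally show ?thesis using True by simp
  next
    case False
    then have "{\<omega> \<in> space D. \<forall>i\<le>n. W i \<omega> = s i} = {}" by force
    with False show ?thesis by (simp only: measure_empty if_False)
  qed
  have inV: "s n \<in> verts G"
    if "s 0 \<in> verts G" "(\<Prod>i<n. pmf (step (s i)) (s (Suc i))) \<noteq> 0" for n s
    using that(2)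
  proof (induction n)
    case (Suc n)
    then have "s n \<in> verts G" "pmf (step (s n)) (s (Suc n)) \<noteq> 0" by auto
    then show ?case
      using G adj_verts[of G "s n" "s (Suc n)"]
      by (auto simp: step trans_fun_def lf_graph_def split: if_splits)
  qed (use that in simp)
  have markov: "measure D {\<omega> \<in> space D. (\<forall>i\<le>n. W i \<omega> = s i) \<and> W (Suc n) \<omega> = y} =
      measure D {\<omega> \<in> space D. \<forall>i\<le>n. W i \<omega> = s i} * trans_fun G (s n) y" for n s y
  proof -
    let ?s = "s(Suc n := y)"
    have "{\<omega> \<in> space D. (\<forall>i\<le>n. W i \<omega> = s i) \<and> W (Suc n) \<omega> = y} =
        {\<omega> \<in> space D. \<forall>i\<le>Suc n. W i \<omega> = ?s i}"
      by (auto simp: le_Suc_eq simp del: W_simps)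
    then have eq: "measure D {\<omega> \<in> space D. (\<forall>i\<le>n. W i \<omega> = s i) \<and> W (Suc n) \<omega> = y} =
        (if s 0 = x then (\<Prod>i<n. pmf (step (s i)) (s (Suc i))) * pmf (step (s n)) y else 0)"
      by (simp only: path) simp
    show ?thesis
    proof (cases "s 0 = x \<and> (\<Prod>i<n. pmf (step (s i)) (s (Suc i))) \<noteq> 0")
      case True
      with inV[of s n] x show ?thesis by (simp add: eq path step del: W_simps)
    next
      case False
      then show ?thesis by (auto simp: eq path simp del: W_simps)
    qed
  qed
  define C where "C = (\<Pi>\<^sub>M n\<in>(UNIV::nat set). count_space (UNIV::'v set))"
  define T where "T \<omega> n = W n \<omega>" for \<omega> n
  have T [measurable]: "T \<in> D \<rightarrow>\<^sub>M C"
    unfolding C_def T_def[abs_def] by (rule measurable_PiM_single') auto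
  have coord [measurable]: "(\<lambda>Z. Z n) \<in> C \<rightarrow>\<^sub>M count_space UNIV" for n
    unfolding C_def by (rule measurable_component_singleton) simp
  have push: "measure (distr D C T) {Z \<in> space C. Q Z} = measure D {\<omega> \<in> space D. Q (T \<omega>)}"
    if [measurable]: "Measurable.pred C Q" for Q
    by (subst measure_distr) (auto intro!: arg_cong[where f = "measure D"] dest: measurable_space[OF T])
  have "discrete_srw G x (distr D C T) (\<lambda>n Z. Z n)"
    unfolding discrete_srw_def
  proof (intro conjI allI)
    show "prob_space (distr D C T)" by (rule prob_space.prob_space_distr[OF prob_D T])
    show "(\<lambda>Z. Z n) \<in> distr D C T \<rightarrow>\<^sub>M count_space UNIV" for n by simp
    show "AE Z in distr D C T. Z 0 = x"
      by (subst AE_distr_iff) (auto simp: T_def)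
    fix n s y
    show "measure (distr D C T)
          {Z \<in> space (distr D C T). (\<forall>i\<le>n. Z i = s i) \<and> Z (Suc n) = y} =
        measure (distr D C T) {Z \<in> space (distr D C T). \<forall>i\<le>n. Z i = s i} * trans_fun G (s n) y"
      unfolding space_distr by (subst (1 2) push) (auto simp only: T_def markov, measurable)
  qed
  then show ?thesis
    unfolding srw_law_def by (intro exI[of _ "distr D C T"]) (simp add: C_def)
qed

definition discrete_finite_collision :: "'v graph \<Rightarrow> bool" where
  "discrete_finite_collision G \<longleftrightarrow>
     (\<forall>x\<in>verts G. \<forall>\<mu>. srw_law G x \<mu> \<longrightarrow>
        (AE (X, Y) in \<mu> \<Otimes>\<^sub>M \<mu>. finite {n. X n = Y n}))"

text \<open>
  The chain with jump rates \<open>trans_fun G\<close> leaves every vertex at total rate 1, so it is the discrete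
  walk \<open>Z\<close> run with independent exponential holding times \<open>\<xi>\<close> of mean 1: \<open>card {k. \<dots>}\<close> is the number
  of jumps up to time \<open>t\<close>, and the \<open>k\<close>-th jump (counted from 0) occurs at time \<open>\<Sum>i\<le>k. \<xi> i\<close>.
  Before time 0 the path is constantly equal to its initial vertex.
\<close>

definition ctime_path :: "(nat \<Rightarrow> 'v) \<times> (nat \<Rightarrow> real) \<Rightarrow> real \<Rightarrow> 'v" where
  "ctime_path = (\<lambda>(Z, \<xi>) t. Z (card {k. (\<Sum>i\<le>k. \<xi> i) \<le> t}))"

definition ctime_srw_law :: "(nat \<Rightarrow> 'v) measure \<Rightarrow> ((nat \<Rightarrow> 'v) \<times> (nat \<Rightarrow> real)) measure" where
  "ctime_srw_law \<mu> = \<mu> \<Otimes>\<^sub>M (\<Pi>\<^sub>M k\<in>UNIV. density lborel (exponential_density 1))"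

text \<open>Left limit in the discrete topology on the vertex set.\<close>

definition left_limit :: "(real \<Rightarrow> 'v) \<Rightarrow> real \<Rightarrow> 'v" where
  "left_limit f t = (THE v. eventually (\<lambda>s. f s = v) (at_left t))"

definition continuous_finite_collision :: "'v graph \<Rightarrow> bool" where
  "continuous_finite_collision G \<longleftrightarrow>
     (\<forall>x\<in>verts G. \<forall>\<mu>. srw_law G x \<mu> \<longrightarrow>
        (AE (a, b) in ctime_srw_law \<mu> \<Otimes>\<^sub>M ctime_srw_law \<mu>.
           finite {t. t \<ge> 0 \<and> left_limit (ctime_path a) t \<noteq> left_limit (ctime_path b) t \<and>
                      ctime_path a t = ctime_path b t}))"

end

theory Submission
  imports Defs
begin

text \<open>
  Write \<open>p\<^sub>n\<close> for the transition probabilities. For weights \<open>w\<close> with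
  \<open>\<Sum>i\<le>n. w i (n - i) \<le> 1\<close>, let \<open>D(u)\<close> be the sum of \<open>w i j * p\<^sub>i(u,v) * p\<^sub>j(u,v)\<close> over
  \<open>i\<close>, \<open>j\<close> and \<open>v\<close>. Transporting the mass \<open>deg(u) * w i j * p\<^sub>i(u,v) * p\<^sub>j(u,v)\<close> from \<open>u\<close> to \<open>v\<close> and
  using reversibility, \<open>deg(u) * p\<^sub>i(u,v) = deg(v) * p\<^sub>i(v,u)\<close>, bounds the expectation of
  \<open>deg(\<rho>) * D(\<rho>)\<close> by that of \<open>deg(\<rho>) * (\<Sum>n. p\<^sub>n(\<rho>,\<rho>))\<close>. So \<open>D(\<rho>)\<close> is almost surely
  finite, and by connectedness so is \<open>D\<close> at every vertex. The weights \<open>w i j = 1\<close> for \<open>i = j\<close> and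
  \<open>0\<close> otherwise make \<open>D\<close> the expected number of discrete collisions. For the continuous walks let
  \<open>w i j\<close> be the probability that at some time the two walks have made \<open>i\<close> and \<open>j\<close> jumps; then \<open>D\<close>
  bounds the expected number of continuous collisions.
\<close>

section \<open>Transition probabilities\<close>

lemma finite_adj: "lf_graph G \<Longrightarrow> finite {z. adj G x z}"
proof (cases "x \<in> verts G")
  case False
  assume "lf_graph G"
  then have "{z. adj G x z} = {}" using False adj_verts[of G x] by (auto simp: lf_graph_def)
  then show ?thesis by simp
qed (auto simp: lf_graph_def locally_finite_def)

lemma trans_fun_nonneg: "0 \<le> trans_fun G x y"
  by (simp add: trans_fun_def)

lemma trans_fun_n_nonneg: "0 \<le> trans_fun_n G n x y"
  by (induction n arbitrary: x) (auto intro!: sum_nonneg mult_nonneg_nonneg trans_fun_nonneg)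

text \<open>Written as an integral over all vertices, the neighbour sum becomes accessible to
  Tonelli. Nothing is added, since \<open>trans_fun G x\<close> vanishes off the neighbours of
  \<open>x\<close>.\<close>

lemma trans_fun_n_Suc_nn_integral:
  assumes "lf_graph G"
  shows "ennreal (trans_fun_n G (Suc n) x y) =
    (\<integral>\<^sup>+z. ennreal (trans_fun G x z) * ennreal (trans_fun_n G n z y) \<partial>count_space UNIV)"
proof -
  have "ennreal (trans_fun_n G (Suc n) x y) =
      (\<Sum>z | adj G x z. ennreal (trans_fun G x z) * ennreal (trans_fun_n G n z y))"
    by (simp add: trans_fun_nonneg trans_fun_n_nonneg ennreal_mult flip: sum_ennreal)
  also have "\<dots> = (\<integral>\<^sup>+z. ennreal (trans_fun G x z) * ennreal (trans_fun_n G n z y) \<partial>count_space UNIV)"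
    by (rule nn_integral_count_space'[symmetric])
      (auto simp: finite_adj assms trans_fun_def split: if_splits)
  finally show ?thesis .
qed

text \<open>Chapman-Kolmogorov, by splitting off the first of the \<open>m\<close> steps;
  countability of the vertex type justifies exchanging the two sums.\<close>

lemma trans_fun_n_add:
  fixes G :: "'v::countable graph"
  assumes G: "lf_graph G"
  shows "ennreal (trans_fun_n G (m + n) x y) =
    (\<integral>\<^sup>+z. ennreal (trans_fun_n G m x z) * ennreal (trans_fun_n G n z y) \<partial>count_space UNIV)"
proof (induction m arbitrary: x)
  case 0
  have "(\<integral>\<^sup>+z. ennreal (trans_fun_n G 0 x z) * ennreal (trans_fun_n G n z y) \<partial>count_space UNIV)
     = (\<Sum>z\<in>{x}. ennreal (trans_fun_n G 0 x z) * ennreal (trans_fun_n G n z y))"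
    by (rule nn_integral_count_space') (auto split: if_splits)
  then show ?case by simp
next
  case (Suc m)
  have "ennreal (trans_fun_n G (Suc m + n) x y) =
    (\<integral>\<^sup>+u. ennreal (trans_fun G x u) *
      (\<integral>\<^sup>+z. ennreal (trans_fun_n G m u z) * ennreal (trans_fun_n G n z y) \<partial>count_space UNIV) \<partial>count_space UNIV)"
    by (simp only: add_Suc trans_fun_n_Suc_nn_integral[OF G] Suc)
  also have "\<dots> = (\<integral>\<^sup>+u. (\<integral>\<^sup>+z. ennreal (trans_fun G x u) * ennreal (trans_fun_n G m u z) *
      ennreal (trans_fun_n G n z y) \<partial>count_space UNIV) \<partial>count_space UNIV)"
    by (simp add: nn_integral_cmult mult.assoc)
  also have "\<dots> = (\<integral>\<^sup>+z. (\<integral>\<^sup>+u. ennreal (trans_fun G x u) * ennreal (trans_fun_n G m u z) *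
      ennreal (trans_fun_n G n z y) \<partial>count_space UNIV) \<partial>count_space UNIV)"
    by (rule nn_integral_count_space_nn_integral) auto
  also have "\<dots> = (\<integral>\<^sup>+z. ennreal (trans_fun_n G (Suc m) x z) * ennreal (trans_fun_n G n z y) \<partial>count_space UNIV)"
    by (simp add: nn_integral_multc trans_fun_n_Suc_nn_integral[OF G] del: trans_fun_n.simps)
  finally show ?case .
qed

lemma trans_fun_n_1: "lf_graph G \<Longrightarrow> trans_fun_n G 1 x y = trans_fun G x y"
  using sum.delta[of "{z. adj G x z}" y "trans_fun G x"]
  by (auto simp: finite_adj trans_fun_def if_distrib[of "(*) _"] cong: if_cong)

text \<open>Across an edge both sides are 1, because both end points have positive degree; otherwise
  both are 0.\<close>

lemma trans_fun_reversible:
  assumes "lf_graph G"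
  shows "real (vertex_degree G x) * trans_fun G x y = real (vertex_degree G y) * trans_fun G y x"
proof (cases "adj G x y")
  case True
  then have "adj G y x" by (simp add: adj_sym)
  with True have "vertex_degree G x > 0" "vertex_degree G y > 0"
    using finite_adj[OF assms] by (auto simp: vertex_degree_def card_gt_0_iff)
  with True \<open>adj G y x\<close> show ?thesis by (simp add: trans_fun_def)
qed (auto simp: trans_fun_def adj_sym)

text \<open>The degree factor is carried across the first step, from \<open>x\<close> to
  \<open>z\<close>, and by induction across the remaining \<open>n\<close> steps, from
  \<open>z\<close> to \<open>y\<close>.\<close>

lemma trans_fun_n_reversible:
  fixes G :: "'v::countable graph"
  assumes G: "lf_graph G"
  shows "of_nat (vertex_degree G x) * ennreal (trans_fun_n G n x y) =
    of_nat (vertex_degree G y) * ennreal (trans_fun_n G n y x)"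
proof (induction n arbitrary: x y)
  case (Suc n)
  have 1: "of_nat (vertex_degree G x) * ennreal (trans_fun G x z) =
      of_nat (vertex_degree G z) * ennreal (trans_fun G z x)" for x z
    using trans_fun_reversible[OF G, of x z]
    by (metis ennreal_mult ennreal_of_nat_eq_real_of_nat of_nat_0_le_iff trans_fun_nonneg)
  have "of_nat (vertex_degree G x) * ennreal (trans_fun_n G (Suc n) x y) =
     (\<integral>\<^sup>+z. (of_nat (vertex_degree G x) * ennreal (trans_fun G x z)) * ennreal (trans_fun_n G n z y) \<partial>count_space UNIV)"
    by (simp add: nn_integral_cmult trans_fun_n_Suc_nn_integral[OF G] mult.assoc del: trans_fun_n.simps)
  also have "\<dots> = (\<integral>\<^sup>+z. of_nat (vertex_degree G y) * (ennreal (trans_fun_n G n y z) * ennreal (trans_fun G z x)) \<partial>count_space UNIV)"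
    unfolding 1[of x] using Suc[of _ y] by (intro nn_integral_cong) (metis mult.commute mult.assoc)
  \<comment> \<open>The reversed path takes its extra step at the end, while
    \<open>trans_fun_n\<close> recurses on the first step; splitting \<open>n + 1\<close> bridges
    the two.\<close>
  also have "\<dots> = of_nat (vertex_degree G y) * ennreal (trans_fun_n G (n + 1) y x)"
    by (simp only: trans_fun_n_add[OF G] trans_fun_n_1[OF G]) (simp add: nn_integral_cmult)
  finally show ?case by simp
qed auto

lemma trans_fun_n_eq_0:
  assumes "\<not> (adj G ^^ n) x y"
  shows "trans_fun_n G n x y = 0"
  using assms
proof (induction n arbitrary: x)
  case (Suc n)
  have "\<not> (adj G ^^ n) z y" if "adj G x z" for z
    using Suc.prems that relpowp_Suc_I2 by metis
  with Suc.IH show ?case by simp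
qed auto

lemma trans_fun_n_outside:
  assumes "lf_graph G" "x \<in> verts G" "y \<notin> verts G"
  shows "trans_fun_n G n x y = 0"
proof (rule trans_fun_n_eq_0)
  show "\<not> (adj G ^^ n) x y"
    using assms by (cases n) (auto simp: lf_graph_def dest: adj_verts)
qed

lemma trans_fun_n_degree_0:
  assumes "lf_graph G" "vertex_degree G x = 0"
  shows "trans_fun_n G n x y = (if n = 0 \<and> x = y then 1 else 0)"
proof (cases n)
  case (Suc m)
  have "{z. adj G x z} = {}" using assms finite_adj[OF assms(1), of x] by (simp add: vertex_degree_def)
  then show ?thesis using Suc by (simp del: Collect_empty_eq)
qed auto

section \<open>Weighted numbers of meetings\<close>

text \<open>Pairs of times are grouped by antidiagonals \<open>i + j = n\<close>: the bound on
  \<open>w\<close> is stated per antidiagonal, and reversibility turns each of its terms into a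
  return in \<open>n\<close> steps.\<close>

definition meetings :: "(nat \<Rightarrow> nat \<Rightarrow> ennreal) \<Rightarrow> 'v graph \<Rightarrow> 'v \<Rightarrow> 'v \<Rightarrow> ennreal" where
  "meetings w G u v = (\<Sum>n. \<Sum>i\<le>n. w i (n - i) *
     (ennreal (trans_fun_n G i u v) * ennreal (trans_fun_n G (n - i) u v)))"

definition total_meetings :: "(nat \<Rightarrow> nat \<Rightarrow> ennreal) \<Rightarrow> 'v graph \<Rightarrow> 'v \<Rightarrow> ennreal" where
  "total_meetings w G u = (\<integral>\<^sup>+v. meetings w G u v \<partial>count_space UNIV)"

text \<open>For two independent walks from \<open>u\<close>, the probability that one after
  \<open>i\<close> steps is where the other is after \<open>j\<close> steps; see
  \<open>srw_law_meeting\<close>.\<close>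

definition meeting_prob :: "'v graph \<Rightarrow> nat \<Rightarrow> nat \<Rightarrow> 'v \<Rightarrow> ennreal" where
  "meeting_prob G i j u =
     (\<integral>\<^sup>+v. ennreal (trans_fun_n G i u v) * ennreal (trans_fun_n G j u v) \<partial>count_space UNIV)"

lemma total_meetings_eq:
  "total_meetings w G u = (\<Sum>n. \<Sum>i\<le>n. w i (n - i) * meeting_prob G i (n - i) u)"
  unfolding total_meetings_def meetings_def meeting_prob_def
  by (simp add: nn_integral_suminf nn_integral_sum nn_integral_cmult)

lemma meetings_outside:
  assumes "lf_graph G" "u \<in> verts G" "v \<notin> verts G"
  shows "meetings w G u v = 0"
  unfolding meetings_def using assms by (simp add: trans_fun_n_outside)

lemma nn_integral_meetings_verts:
  assumes "lf_graph G" "u \<in> verts G"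
  shows "(\<integral>\<^sup>+v. meetings w G u v \<partial>count_space (verts G)) = total_meetings w G u"
  unfolding total_meetings_def using meetings_outside[OF assms, of _ w]
  by (intro nn_integral_count_space_eq) auto

text \<open>Reversibility turns the two walks meeting at \<open>v\<close> into one walk that returns to \<open>v\<close>.\<close>

lemma nn_integral_degree_meetings_le:
  fixes G :: "'v::countable graph"
  assumes G: "lf_graph G" and w: "\<And>n. (\<Sum>i\<le>n. w i (n - i)) \<le> 1"
  shows "(\<integral>\<^sup>+u. of_nat (vertex_degree G u) * meetings w G u v \<partial>count_space UNIV)
    \<le> of_nat (vertex_degree G v) * (\<Sum>n. ennreal (trans_fun_n G n v v))"
proof -
  let ?p = "\<lambda>n x y. ennreal (trans_fun_n G n x y)" and ?d = "\<lambda>x. of_nat (vertex_degree G x) :: ennreal"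
  have "?d u * meetings w G u v = (\<Sum>n. \<Sum>i\<le>n. w i (n - i) * (?d u * ?p i u v * ?p (n - i) u v))" for u
    unfolding meetings_def ennreal_suminf_cmult[symmetric] sum_distrib_left by (simp add: ac_simps)
  then have "(\<integral>\<^sup>+u. ?d u * meetings w G u v \<partial>count_space UNIV) =
     (\<integral>\<^sup>+u. (\<Sum>n. \<Sum>i\<le>n. w i (n - i) * (?d v * (?p i v u * ?p (n - i) u v))) \<partial>count_space UNIV)"
    by (simp add: trans_fun_n_reversible[OF G, of _ _ v] mult.assoc)
  \<comment> \<open>After Tonelli, the sum over \<open>u\<close> is Chapman-Kolmogorov from
    \<open>v\<close> back to \<open>v\<close> in \<open>i + (n - i) = n\<close> steps, so only the
    weight still depends on \<open>i\<close>.\<close>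
  also have "\<dots> = (\<Sum>n. \<Sum>i\<le>n. w i (n - i) * (?d v * ?p n v v))"
    by (simp add: nn_integral_suminf nn_integral_sum nn_integral_cmult flip: trans_fun_n_add[OF G])
  also have "\<dots> = (\<Sum>n. (\<Sum>i\<le>n. w i (n - i)) * (?d v * ?p n v v))"
    by (simp add: sum_distrib_right)
  also have "\<dots> \<le> (\<Sum>n. 1 * (?d v * ?p n v v))"
    by (intro suminf_le mult_right_mono w) auto
  also have "\<dots> = ?d v * (\<Sum>n. ?p n v v)"
    by simp
  finally show ?thesis .
qed

text \<open>No step is possible from such a vertex, so only \<open>i = j = 0\<close> survives. The
  case is treated apart because a zero degree makes the degree-weighted expectation
  uninformative.\<close>

lemma total_meetings_degree_0:
  assumes "lf_graph G" "vertex_degree G u = 0"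
  shows "total_meetings w G u = w 0 0"
proof -
  have p: "ennreal (trans_fun_n G n u v) = (if n = 0 \<and> u = v then 1 else 0)" for n v
    using trans_fun_n_degree_0[OF assms] by simp
  have m: "meeting_prob G i j u = (if i = 0 \<and> j = 0 then 1 else 0)" for i j
  proof -
    have "meeting_prob G i j u = (\<integral>\<^sup>+v. (if i = 0 \<and> j = 0 then indicator {u} v else 0) \<partial>count_space UNIV)"
      unfolding meeting_prob_def p by (intro nn_integral_cong) auto
    then show ?thesis by simp
  qed
  have "total_meetings w G u = (\<Sum>n. if n = 0 then w 0 0 else 0)"
    unfolding total_meetings_eq m
    by (intro suminf_cong) (auto intro!: sum.neutral)
  also have "\<dots> = w 0 0" using suminf_finite[of "{0::nat}" "\<lambda>n. if n = 0 then w 0 0 else 0"] by simp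
  finally show ?thesis .
qed

section \<open>Spreading finiteness from one vertex to the whole graph\<close>

text \<open>Let both walks jump to \<open>z\<close> first: this shifts both times by one and costs
  the square of the jump probability.\<close>

lemma meeting_prob_step:
  assumes G: "lf_graph G"
  shows "(ennreal (trans_fun G u z) * ennreal (trans_fun G u z)) * meeting_prob G i j z
    \<le> meeting_prob G (Suc i) (Suc j) u"
proof -
  have step: "ennreal (trans_fun G u z) * ennreal (trans_fun_n G n z v) \<le> ennreal (trans_fun_n G (Suc n) u v)" for n v
  proof -
    have "ennreal (trans_fun G u z) * ennreal (trans_fun_n G n z v) =
       (\<integral>\<^sup>+x. ennreal (trans_fun G u x) * ennreal (trans_fun_n G n x v) * indicator {z} x \<partial>count_space UNIV)"
      by simp
    also have "\<dots> \<le> ennreal (trans_fun_n G (Suc n) u v)"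
      unfolding trans_fun_n_Suc_nn_integral[OF G] by (intro nn_integral_mono) (simp split: split_indicator)
    finally show ?thesis .
  qed
  have "(ennreal (trans_fun G u z) * ennreal (trans_fun G u z)) * meeting_prob G i j z =
    (\<integral>\<^sup>+v. (ennreal (trans_fun G u z) * ennreal (trans_fun_n G i z v)) *
      (ennreal (trans_fun G u z) * ennreal (trans_fun_n G j z v)) \<partial>count_space UNIV)"
    unfolding meeting_prob_def by (subst nn_integral_cmult[symmetric]) (auto simp: ac_simps)
  also have "\<dots> \<le> meeting_prob G (Suc i) (Suc j) u"
    unfolding meeting_prob_def by (intro nn_integral_mono mult_mono step) auto
  finally show ?thesis .
qed

text \<open>By \<open>meeting_prob_step\<close>, the antidiagonal \<open>n\<close> at
  \<open>z\<close> is dominated, up to a constant, by the antidiagonal \<open>n + 2\<close> at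
  \<open>u\<close>. The hypothesis on \<open>w\<close> compares the weights before and after this
  shift.\<close>

lemma total_meetings_adj:
  assumes G: "lf_graph G" and w: "\<And>i j. w i j / 2 \<le> w (Suc i) (Suc j)"
    and fin: "total_meetings w G u < \<infinity>" and uz: "adj G u z"
  shows "total_meetings w G z < \<infinity>"
proof -
  \<comment> \<open>The square is the probability that both walks jump from \<open>u\<close> to
    \<open>z\<close>; the 1/2 is the loss allowed by the hypothesis on \<open>w\<close>.\<close>
  define c where "c = ennreal (trans_fun G u z) * ennreal (trans_fun G u z) / 2"
  have "vertex_degree G u > 0"
    using uz finite_adj[OF G, of u] by (auto simp: vertex_degree_def card_gt_0_iff)
  then have "0 < trans_fun G u z" using uz by (simp add: trans_fun_def)
  then have "ennreal (trans_fun G u z) \<noteq> 0" by simp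
  then have "c \<noteq> 0" unfolding c_def by simp
  let ?f = "\<lambda>n. \<Sum>i\<le>n. w i (n - i) * meeting_prob G i (n - i) u"
  have le: "c * (\<Sum>i\<le>n. w i (n - i) * meeting_prob G i (n - i) z) \<le> ?f (n + 2)" for n
  proof -
    have "c * (\<Sum>i\<le>n. w i (n - i) * meeting_prob G i (n - i) z) =
      (\<Sum>i\<le>n. w i (n - i) / 2 * ((ennreal (trans_fun G u z) * ennreal (trans_fun G u z)) * meeting_prob G i (n - i) z))"
      unfolding sum_distrib_left
    proof (rule sum.cong)
      fix i
      show "c * (w i (n - i) * meeting_prob G i (n - i) z) = w i (n - i) / 2 *
          ((ennreal (trans_fun G u z) * ennreal (trans_fun G u z)) * meeting_prob G i (n - i) z)"
        unfolding c_def divide_ennreal_def by (simp only: mult.assoc mult.left_commute)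
    qed simp
    also have "\<dots> \<le> (\<Sum>i\<le>n. w (Suc i) (Suc (n - i)) * meeting_prob G (Suc i) (Suc (n - i)) u)"
      by (intro sum_mono mult_mono w meeting_prob_step G) auto
    \<comment> \<open>The shifted indices lie on the antidiagonal \<open>n + 2\<close> and miss only
      its end points \<open>0\<close> and \<open>n + 2\<close>.\<close>
    also have "\<dots> = (\<Sum>i\<in>Suc ` {..n}. w i (n + 2 - i) * meeting_prob G i (n + 2 - i) u)"
      by (subst sum.reindex) (auto simp: Suc_diff_le)
    also have "\<dots> \<le> ?f (n + 2)"
      by (rule sum_mono2) auto
    finally show ?thesis .
  qed
  have "c * total_meetings w G z \<le> (\<Sum>n. ?f (n + 2))"
    unfolding total_meetings_eq ennreal_suminf_cmult[symmetric] by (intro suminf_le le) auto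
  \<comment> \<open>Adding back the antidiagonals 0 and 1 completes the series at
    \<open>u\<close>.\<close>
  also have "\<dots> \<le> (\<Sum>n. ?f (n + 2)) + (\<Sum>n<2. ?f n)" by simp
  also have "\<dots> = total_meetings w G u"
    unfolding total_meetings_eq by (rule suminf_offset[symmetric]) auto
  finally have "c * total_meetings w G z < \<infinity>" using fin by (rule le_less_trans)
  with \<open>c \<noteq> 0\<close> show ?thesis by (auto simp: ennreal_mult_less_top)
qed

text \<open>Up to a factor 2, the smallest majorant of \<open>w\<close> to which \<open>total_meetings_adj\<close> applies:
  the discounted sum of \<open>w\<close> along a diagonal.\<close>

fun diag_sum :: "(nat \<Rightarrow> nat \<Rightarrow> ennreal) \<Rightarrow> nat \<Rightarrow> nat \<Rightarrow> ennreal" where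
  "diag_sum w (Suc i) (Suc j) = w (Suc i) (Suc j) / 2 + diag_sum w i j / 2"
| "diag_sum w i j = w i j / 2"

lemma le_diag_sum: "w i j \<le> 2 * diag_sum w i j"
proof -
  have "w i j / 2 \<le> diag_sum w i j"
    by (induction w i j rule: diag_sum.induct) auto
  then have "2 * (w i j / 2) \<le> 2 * diag_sum w i j" by (rule mult_left_mono) simp
  moreover have "2 * (w i j / 2) = w i j"
    using mult_divide_eq_ennreal[of 2 "w i j"] by (simp add: ennreal_times_divide mult.commute)
  ultimately show ?thesis by simp
qed

text \<open>The antidiagonal sum of \<open>diag_sum w\<close> at \<open>n\<close> is half that of
  \<open>w\<close> at \<open>n\<close> plus half that of \<open>diag_sum w\<close> at
  \<open>n - 2\<close>. Induction in steps of two therefore preserves the bound 1.\<close>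

lemma sum_diag_sum_le:
  assumes w: "\<And>n. (\<Sum>i\<le>n. w i (n - i)) \<le> 1"
  shows "(\<Sum>i\<le>n. diag_sum w i (n - i)) \<le> 1"
proof (induction n rule: less_induct)
  case (less n)
  have halves: "(1::ennreal) / 2 + 1 / 2 = 1" by (simp flip: add_divide_distrib_ennreal)
  have "(1::ennreal) / 2 \<le> 1 / 2 + 1 / 2" by (rule add_increasing2) simp_all
  then have half: "(1::ennreal) / 2 \<le> 1" by (simp only: halves)
  have wh: "(\<Sum>i\<le>n. w i (n - i)) / 2 \<le> 1 / 2" for n
    by (rule divide_right_mono_ennreal[OF w])
  consider "n = 0" | "n = 1" | m where "n = Suc (Suc m)" by (metis One_nat_def nat.exhaust)
  then show ?case
  proof cases
    case 1 then show ?thesis using order_trans[OF wh[of 0] half] by simp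
  next
    case 2 then show ?thesis
      using order_trans[OF wh[of 1] half] by (simp add: divide_ennreal_def distrib_right)
  next
    case (3 m)
    \<comment> \<open>The two end points have no predecessor on their diagonals; an inner point
      \<open>(Suc i, n - Suc i)\<close> has the predecessor \<open>(i, m - i)\<close>.\<close>
    have split: "(\<Sum>i\<le>n. g i) = g 0 + (\<Sum>i\<le>m. g (Suc i)) + g n" for g :: "nat \<Rightarrow> ennreal"
      by (simp only: 3 sum.atMost_Suc[of g "Suc m"] sum.atMost_Suc_shift[of g m])
    have sum_half: "(\<Sum>i\<le>m. g i / 2) = (\<Sum>i\<le>m. g i) / 2" for g :: "nat \<Rightarrow> ennreal"
      unfolding divide_ennreal_def by (rule sum_distrib_right[symmetric])
    have "(\<Sum>i\<le>m. diag_sum w (Suc i) (n - Suc i)) =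
        (\<Sum>i\<le>m. w (Suc i) (n - Suc i) / 2 + diag_sum w i (m - i) / 2)"
      by (intro sum.cong) (auto simp: 3 Suc_diff_le)
    also have "\<dots> = (\<Sum>i\<le>m. w (Suc i) (n - Suc i)) / 2 + (\<Sum>i\<le>m. diag_sum w i (m - i)) / 2"
      by (simp only: sum.distrib sum_half)
    finally have "(\<Sum>i\<le>n. diag_sum w i (n - i)) =
        (\<Sum>i\<le>n. w i (n - i)) / 2 + (\<Sum>i\<le>m. diag_sum w i (m - i)) / 2"
      unfolding split by (simp only: add_divide_distrib_ennreal) (simp add: 3 add.commute add.left_commute)
    also have "\<dots> \<le> 1 / 2 + 1 / 2"
      using less[of m] by (intro add_mono wh divide_right_mono_ennreal) (simp add: 3)
    also note halves
    finally show ?thesis .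
  qed
qed

lemma total_meetings_mono:
  assumes "\<And>i j. w i j \<le> c * w' i j"
  shows "total_meetings w G u \<le> c * total_meetings w' G u"
  unfolding total_meetings_eq ennreal_suminf_cmult[symmetric] sum_distrib_left mult.assoc[symmetric]
  using assms by (intro suminf_le sum_mono mult_right_mono) auto

lemma total_meetings_connected:
  assumes G: "lf_graph G" and w: "\<And>i j. w i j / 2 \<le> w (Suc i) (Suc j)"
    and fin: "total_meetings w G u < \<infinity>" and "u \<in> verts G" "v \<in> verts G"
  shows "total_meetings w G v < \<infinity>"
proof -
  have "(adj G)\<^sup>*\<^sup>* u v" using assms by (auto simp: lf_graph_def connected_graph_def)
  then show ?thesis
    by (induction rule: rtranclp_induct) (use fin total_meetings_adj[OF G, of w] w in auto)
qed

section \<open>Locality and mass transport\<close>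

lemma gdist_adj_le:
  assumes "lf_graph G" "x \<in> verts G" "adj G u z"
  shows "gdist G x z \<le> Suc (gdist G x u)"
proof (rule gdist_le)
  have "u \<in> verts G" using assms adj_verts[of G u z] by (auto simp: lf_graph_def)
  then show "(adj G ^^ Suc (gdist G x u)) x z"
    using relpowp_gdist[OF assms(1,2)] assms(3) by (auto intro: relpowp_Suc_I)
qed

text \<open>Strictly inside the ball every neighbour of \<open>u\<close> still lies in the ball, so
  an isomorphism of balls sees the whole neighbourhood of \<open>u\<close>.\<close>

lemma gball_iso_neighbours:
  assumes iso: "graph_iso \<phi> (gball G x m) (gball H y m)" and xy: "\<phi> x = y"
    and G: "lf_graph G" "x \<in> verts G" and H: "lf_graph H" "y \<in> verts H"
    and u: "u \<in> verts G" "gdist G x u < m"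
  shows "bij_betw \<phi> {z. adj G u z} {z. adj H (\<phi> u) z}"
proof -
  have b: "bij_betw \<phi> (verts (gball G x m)) (verts (gball H y m))"
    using iso by (simp add: graph_iso_def)
  have ub: "u \<in> verts (gball G x m)" using u by (simp add: verts_gball)
  then have \<phi>u: "\<phi> u \<in> verts (gball H y m)" using bij_betwE[OF b] by blast
  have d: "gdist H y (\<phi> u) = gdist G x u" by (rule gball_iso_gdist[OF iso xy G H ub])
  have nG: "z \<in> verts (gball G x m)" if "adj G u z" for z
    using gdist_adj_le[OF G that] adj_verts[of G u z] that u G by (auto simp: verts_gball lf_graph_def)
  have nH: "w \<in> verts (gball H y m)" if "adj H (\<phi> u) w" for w
    using gdist_adj_le[OF H that] adj_verts[of H "\<phi> u" w] that u d H by (auto simp: verts_gball lf_graph_def)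
  have adj_iff: "adj G u z \<longleftrightarrow> adj H (\<phi> u) (\<phi> z)" if z: "z \<in> verts (gball G x m)" for z
  proof -
    have "\<phi> z \<in> verts (gball H y m)" using bij_betwE[OF b] z by blast
    moreover have "adj (gball G x m) u z \<longleftrightarrow> adj (gball H y m) (\<phi> u) (\<phi> z)"
      using iso ub z by (auto simp: graph_iso_def)
    ultimately show ?thesis using z ub \<phi>u by (simp add: adj_gball)
  qed
  have "inj_on \<phi> {z. adj G u z}"
    using b nG by (auto simp: bij_betw_def inj_on_def)
  moreover have "w \<in> \<phi> ` {z. adj G u z}" if "adj H (\<phi> u) w" for w
  proof -
    have "w \<in> \<phi> ` verts (gball G x m)" using nH[OF that] b by (simp add: bij_betw_def)
    with adj_iff that show ?thesis by auto
  qed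
  ultimately show ?thesis using nG adj_iff by (auto simp: bij_betw_def)
qed

lemma gball_iso_vertex_degree:
  assumes iso: "graph_iso \<phi> (gball G x m) (gball H y m)" and xy: "\<phi> x = y"
    and G: "lf_graph G" "x \<in> verts G" and H: "lf_graph H" "y \<in> verts H"
    and u: "u \<in> verts G" "gdist G x u < m"
  shows "vertex_degree G u = vertex_degree H (\<phi> u)"
  unfolding vertex_degree_def using gball_iso_neighbours[OF assms] by (rule bij_betw_same_card)

text \<open>Each step uses up one unit of the radius left between \<open>u\<close> and the boundary.
  The bound \<open>gdist G x u + n \<le> m\<close> keeps all vertices that the walk leaves in the
  interior.\<close>

lemma gball_iso_trans_fun_n:
  assumes iso: "graph_iso \<phi> (gball G x m) (gball H y m)" and xy: "\<phi> x = y"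
    and G: "lf_graph G" "x \<in> verts G" and H: "lf_graph H" "y \<in> verts H"
    and u: "u \<in> verts G" "gdist G x u + n \<le> m" and v: "v \<in> verts (gball G x m)"
  shows "trans_fun_n G n u v = trans_fun_n H n (\<phi> u) (\<phi> v)"
  using u
proof (induction n arbitrary: u)
  case 0
  have "inj_on \<phi> (verts (gball G x m))" using iso by (simp add: graph_iso_def bij_betw_def)
  with 0 v show ?case by (auto simp: verts_gball dest: inj_onD)
next
  case (Suc n)
  then have u: "u \<in> verts G" "gdist G x u < m" by auto
  have b: "bij_betw \<phi> {z. adj G u z} {z. adj H (\<phi> u) z}"
    by (rule gball_iso_neighbours[OF iso xy G H u])
  have "trans_fun_n G (Suc n) u v =
      (\<Sum>z | adj G u z. trans_fun H (\<phi> u) (\<phi> z) * trans_fun_n H n (\<phi> z) (\<phi> v))"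
    unfolding trans_fun_n.simps
  proof (rule sum.cong)
    fix z assume z: "z \<in> {z. adj G u z}"
    then have "adj H (\<phi> u) (\<phi> z)" using bij_betwE[OF b] by blast
    then have "trans_fun G u z = trans_fun H (\<phi> u) (\<phi> z)"
      using z gball_iso_vertex_degree[OF iso xy G H u] by (simp add: trans_fun_def)
    moreover have "z \<in> verts G" "gdist G x z + n \<le> m"
      using z adj_verts[of G u z] gdist_adj_le[OF G, of u z] Suc.prems G by (auto simp: lf_graph_def)
    ultimately show "trans_fun G u z * trans_fun_n G n z v =
        trans_fun H (\<phi> u) (\<phi> z) * trans_fun_n H n (\<phi> z) (\<phi> v)"
      using Suc.IH by simp
  qed simp
  also have "\<dots> = trans_fun_n H (Suc n) (\<phi> u) (\<phi> v)"
    using sum.reindex_bij_betw[OF b, of "\<lambda>z. trans_fun H (\<phi> u) z * trans_fun_n H n z (\<phi> v)"] by simp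
  finally show ?case .
qed

text \<open>A walk of \<open>i \<le> m\<close> steps stays in the ball, so outside it the first
  factor vanishes. The finite sum can then be transported by an isomorphism of balls.\<close>

lemma meeting_prob_gball:
  assumes G: "lf_graph G" "x \<in> verts G" and "i \<le> m"
  shows "meeting_prob G i j x =
    (\<Sum>v\<in>verts (gball G x m). ennreal (trans_fun_n G i x v) * ennreal (trans_fun_n G j x v))"
  unfolding meeting_prob_def
proof (rule nn_integral_count_space')
  show "finite (verts (gball G x m))" by (rule finite_gball[OF G])
  fix v assume v: "v \<notin> verts (gball G x m)"
  have "trans_fun_n G i x v = 0"
  proof (cases "v \<in> verts G")
    case True
    with v \<open>i \<le> m\<close> have "\<not> (adj G ^^ i) x v" using gdist_le[of i G x v] by (auto simp: verts_gball)
    then show ?thesis by (rule trans_fun_n_eq_0)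
  qed (rule trans_fun_n_outside[OF G])
  then show "ennreal (trans_fun_n G i x v) * ennreal (trans_fun_n G j x v) = 0" by simp
qed auto

lemma loc_iso_vertex_degree:
  assumes "loc_iso G (x # xs) H (y # ys) m" "0 < m" and G: "lf_graph G" and H: "lf_graph H"
  shows "vertex_degree G x = vertex_degree H y"
proof -
  obtain \<phi> where iso: "graph_iso \<phi> (gball G x m) (gball H y m)" and xy: "\<phi> x = y"
    using assms(1) by (auto elim: loc_isoE)
  have "x \<in> verts G" "y \<in> verts H" using loc_iso_set[OF assms(1)] by (auto simp: verts_gball)
  with gball_iso_vertex_degree[OF iso xy G _ H, of x] xy \<open>0 < m\<close> show ?thesis by simp
qed

lemma loc_iso_trans_fun_n:
  assumes "loc_iso G [x, x'] H [y, y'] m" "n \<le> m" and G: "lf_graph G" and H: "lf_graph H"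
  shows "trans_fun_n G n x x' = trans_fun_n H n y y'"
proof -
  obtain \<phi> where iso: "graph_iso \<phi> (gball G x m) (gball H y m)" and xy: "\<phi> x = y" "\<phi> x' = y'"
    using assms(1) by (auto elim: loc_isoE)
  have "x \<in> verts G" "y \<in> verts H" "x' \<in> verts (gball G x m)"
    using loc_iso_set[OF assms(1)] by (auto simp: verts_gball)
  with gball_iso_trans_fun_n[OF iso xy(1) G _ H, of x n x'] xy \<open>n \<le> m\<close> show ?thesis by simp
qed

lemma loc_iso_meeting_prob:
  assumes "loc_iso G [x] H [y] m" "i \<le> m" "j \<le> m" and G: "lf_graph G" and H: "lf_graph H"
  shows "meeting_prob G i j x = meeting_prob H i j y"
proof -
  obtain \<phi> where iso: "graph_iso \<phi> (gball G x m) (gball H y m)" and xy: "\<phi> x = y"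
    using assms(1) by (auto elim: loc_isoE)
  have x: "x \<in> verts G" and y: "y \<in> verts H" using loc_iso_set[OF assms(1)] by (auto simp: verts_gball)
  have b: "bij_betw \<phi> (verts (gball G x m)) (verts (gball H y m))"
    using iso by (simp add: graph_iso_def)
  have "trans_fun_n G n x v = trans_fun_n H n y (\<phi> v)" if "n \<le> m" "v \<in> verts (gball G x m)" for n v
    using gball_iso_trans_fun_n[OF iso xy G x H y x _ that(2), of n] that xy by simp
  then have "meeting_prob G i j x = (\<Sum>v\<in>verts (gball G x m).
      ennreal (trans_fun_n H i y (\<phi> v)) * ennreal (trans_fun_n H j y (\<phi> v)))"
    using assms(2,3) by (simp add: meeting_prob_gball[OF G x \<open>i \<le> m\<close>])
  also have "\<dots> = meeting_prob H i j y"
    unfolding meeting_prob_gball[OF H y \<open>i \<le> m\<close>] by (rule sum.reindex_bij_betw[OF b])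
  finally show ?thesis .
qed

section \<open>Measurability with respect to the local metric\<close>

text \<open>Every preimage is open, so \<open>f\<close> is continuous. Quantities determined by a
  ball of fixed radius around the root are of this kind.\<close>

lemma borel_measurable_locally_constant:
  fixes f :: "'a::metric_space \<Rightarrow> 'b::topological_space"
  assumes "\<And>x. \<exists>e>0. \<forall>y. dist x y < e \<longrightarrow> f y = f x"
  shows "f \<in> borel_measurable borel"
proof (rule borel_measurable_continuous_onI)
  have "open (f -` S)" for S
    unfolding open_dist using assms by (metis dist_commute vimage_eq)
  then show "continuous_on UNIV f" by (simp add: continuous_on_open_vimage)
qed

text \<open>The radius obtained exceeds \<open>m\<close> strictly, hence is positive even for
  \<open>m = 0\<close>; comparing root degrees requires this.\<close>

lemma loc_dist_lessE:
  assumes "loc_dist G xs H ys < 1 / (real m + 1)"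
  obtains n where "m < n" "loc_iso G xs H ys n"
proof -
  obtain n where n: "loc_iso G xs H ys n" "1 / (real n + 1) < 1 / (real m + 1)"
    using assms by (rule loc_dist_less) simp
  from n(2) have "m < n" by (simp add: field_simps)
  with n(1) show ?thesis by (rule that[rotated])
qed

lemma lf_graph_of: "lf_graph (graph_of g)" and root_of_verts: "root_of g \<in> verts (graph_of g)"
  using rooted_graph_rep(1)[of g] by (auto simp: rooted_iso_def marked_iso_def)

lemma borel_measurable_vertex_degree_root:
  "(\<lambda>g. of_nat (vertex_degree (graph_of g) (root_of g)) :: ennreal) \<in> borel_measurable borel"
proof (rule borel_measurable_locally_constant)
  fix g
  have "vertex_degree (graph_of h) (root_of h) = vertex_degree (graph_of g) (root_of g)"
    if "dist g h < 1 / (real 0 + 1)" for h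
    using that[unfolded dist_rooted_graph_def]
    by (rule loc_dist_lessE) (use loc_iso_vertex_degree lf_graph_of in metis)
  moreover have "0 < 1 / (real 0 + 1)" by simp
  ultimately show "\<exists>e>0. \<forall>h. dist g h < e \<longrightarrow> of_nat (vertex_degree (graph_of h) (root_of h)) =
      (of_nat (vertex_degree (graph_of g) (root_of g)) :: ennreal)"
    by metis
qed

lemma borel_measurable_meeting_prob_root:
  "(\<lambda>g. meeting_prob (graph_of g) i j (root_of g)) \<in> borel_measurable borel"
proof (rule borel_measurable_locally_constant)
  fix g
  have "meeting_prob (graph_of h) i j (root_of h) = meeting_prob (graph_of g) i j (root_of g)"
    if d: "dist g h < 1 / (real (i + j) + 1)" for h
  proof -
    obtain n where "i + j < n" "loc_iso (graph_of g) [root_of g] (graph_of h) [root_of h] n"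
      using d[unfolded dist_rooted_graph_def] by (rule loc_dist_lessE)
    with loc_iso_meeting_prob[of "graph_of g" "root_of g" "graph_of h" "root_of h" n i j] lf_graph_of
    show ?thesis by simp
  qed
  moreover have "0 < 1 / (real (i + j) + 1)" by simp
  ultimately show "\<exists>e>0. \<forall>h. dist g h < e \<longrightarrow>
      meeting_prob (graph_of h) i j (root_of h) = meeting_prob (graph_of g) i j (root_of g)"
    by blast
qed

lemma borel_measurable_total_meetings_root:
  "(\<lambda>g. total_meetings w (graph_of g) (root_of g)) \<in> borel_measurable borel"
  unfolding total_meetings_eq
proof (rule borel_measurable_suminf_order)
  fix n
  have "(\<lambda>g. w i (n - i) * meeting_prob (graph_of g) i (n - i) (root_of g)) \<in> borel_measurable borel" for i
    by (rule borel_measurable_times_ennreal[OF _ borel_measurable_meeting_prob_root]) simp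
  then show "(\<lambda>g. \<Sum>i\<le>n. w i (n - i) * meeting_prob (graph_of g) i (n - i) (root_of g)) \<in> borel_measurable borel"
    by (rule borel_measurable_sum)
qed

text \<open>One term of the mass sent from \<open>u\<close> to \<open>v\<close>. The triple is a
  single argument so that it can be evaluated on a representative of a birooted class.\<close>

definition meeting_term :: "nat \<Rightarrow> nat \<Rightarrow> 'v graph \<times> 'v \<times> 'v \<Rightarrow> ennreal" where
  "meeting_term i j = (\<lambda>(G, u, v). of_nat (vertex_degree G u) *
     (ennreal (trans_fun_n G i u v) * ennreal (trans_fun_n G j u v)))"

lemma loc_iso_meeting_term:
  assumes "loc_iso G [x, x'] H [y, y'] m" "i \<le> m" "j \<le> m" "0 < m" "lf_graph G" "lf_graph H"
  shows "meeting_term i j (G, x, x') = meeting_term i j (H, y, y')"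
  using loc_iso_vertex_degree[OF assms(1,4-6)] loc_iso_trans_fun_n[OF assms(1) _ assms(5,6)] assms(2,3)
  by (simp add: meeting_term_def)

text \<open>The chosen representative is isomorphic to \<open>(G, u, v)\<close>, so their local
  distance is 0 and balls of some radius at least \<open>i + j + 1\<close> agree; this determines
  the term.\<close>

lemma meeting_term_abs_birooted:
  assumes "lf_graph G" "u \<in> verts G" "v \<in> verts G"
  shows "meeting_term i j (rep_birooted_graph (abs_birooted_graph (G, u, v))) = meeting_term i j (G, u, v)"
proof -
  obtain H x y where H: "rep_birooted_graph (abs_birooted_graph (G, u, v)) = (H, x, y)"
    by (metis prod_cases3)
  have "birooted_iso (G, u, v) (G, u, v)"
    using assms by (auto simp: birooted_iso_def intro: marked_iso_refl)
  from Quotient_rep_abs[OF Quotient_birooted_graph this]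
  have "lf_graph H" "marked_iso H [x, y] G [u, v]" by (auto simp: H birooted_iso_def)
  then have "loc_dist H [x, y] G [u, v] = 0"
    using assms by (intro marked_iso_imp_loc_dist) auto
  then obtain n where "loc_iso H [x, y] G [u, v] n" "i + j + 1 \<le> n"
    using loc_dist_zeroD by meson
  then show ?thesis
    using loc_iso_meeting_term[of H x y G u v n i j] assms \<open>lf_graph H\<close> by (simp add: H)
qed

lemma borel_measurable_meeting_term:
  "(\<lambda>g. meeting_term i j (rep_birooted_graph g)) \<in> borel_measurable borel"
proof (rule borel_measurable_locally_constant)
  fix g
  have "meeting_term i j (rep_birooted_graph h) = meeting_term i j (rep_birooted_graph g)"
    if d: "dist g h < 1 / (real (i + j) + 1)" for h
  proof -
    obtain G x x' where "rep_birooted_graph g = (G, x, x')" by (metis prod_cases3)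
    moreover obtain H y y' where "rep_birooted_graph h = (H, y, y')" by (metis prod_cases3)
    moreover note eq = calculation
    have "lf_graph G" "lf_graph H"
      using Quotient_rep_reflp[OF Quotient_birooted_graph, of g]
        Quotient_rep_reflp[OF Quotient_birooted_graph, of h] by (auto simp: eq birooted_iso_def)
    moreover obtain n where "i + j < n" "loc_iso G [x, x'] H [y, y'] n"
      using d[unfolded dist_birooted_graph_def eq prod.case] by (rule loc_dist_lessE)
    ultimately show ?thesis
      using loc_iso_meeting_term[of G x x' H y y' n i j] by (simp add: eq)
  qed
  moreover have "0 < 1 / (real (i + j) + 1)" by simp
  ultimately show "\<exists>e>0. \<forall>h. dist g h < e \<longrightarrow>
      meeting_term i j (rep_birooted_graph h) = meeting_term i j (rep_birooted_graph g)"
    by blast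
qed

section \<open>Mass transport for weighted meetings\<close>

lemma unimodular_meetings:
  fixes M :: "'w measure" and X :: "'w \<Rightarrow> rooted_graph"
  assumes "unimodular M X"
  shows "(\<integral>\<^sup>+\<omega>. (\<integral>\<^sup>+v. of_nat (vertex_degree (graph_of (X \<omega>)) (root_of (X \<omega>))) *
       meetings w (graph_of (X \<omega>)) (root_of (X \<omega>)) v \<partial>count_space (verts (graph_of (X \<omega>)))) \<partial>M) =
     (\<integral>\<^sup>+\<omega>. (\<integral>\<^sup>+u. of_nat (vertex_degree (graph_of (X \<omega>)) u) *
       meetings w (graph_of (X \<omega>)) u (root_of (X \<omega>)) \<partial>count_space (verts (graph_of (X \<omega>)))) \<partial>M)"
proof -
  note borel_measurable_meeting_term [measurable]
  \<comment> \<open>The transport function must live on isomorphism classes. It is built termwise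
    because each term is locally constant, and a countable sum of such terms is still
    measurable.\<close>
  define f where "f g = (\<Sum>n. \<Sum>i\<le>n. w i (n - i) * meeting_term i (n - i) (rep_birooted_graph g))" for g
  have "f \<in> borel_measurable borel"
    unfolding f_def by measurable
  then have eq: "(\<integral>\<^sup>+\<omega>. (\<integral>\<^sup>+v. f (abs_birooted_graph (graph_of (X \<omega>), root_of (X \<omega>), v))
        \<partial>count_space (verts (graph_of (X \<omega>)))) \<partial>M) =
      (\<integral>\<^sup>+\<omega>. (\<integral>\<^sup>+u. f (abs_birooted_graph (graph_of (X \<omega>), u, root_of (X \<omega>)))
        \<partial>count_space (verts (graph_of (X \<omega>)))) \<partial>M)"
    using assms unfolding unimodular_def by blast
  have f_abs: "f (abs_birooted_graph (G, u, v)) = of_nat (vertex_degree G u) * meetings w G u v"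
    if "lf_graph G" "u \<in> verts G" "v \<in> verts G" for G u v
    unfolding f_def meeting_term_abs_birooted[OF that] meetings_def
      ennreal_suminf_cmult[symmetric] sum_distrib_left
    by (simp add: meeting_term_def ac_simps)
  show ?thesis
    using eq by (simp add: f_abs lf_graph_of root_of_verts cong: nn_integral_cong_simp)
qed

lemma AE_total_meetings_root:
  fixes M :: "'w measure" and X :: "'w \<Rightarrow> rooted_graph"
  assumes X [measurable]: "X \<in> borel_measurable M" and uni: "unimodular M X"
    and fin: "(\<integral>\<^sup>+\<omega>. of_nat (vertex_degree (graph_of (X \<omega>)) (root_of (X \<omega>))) *
            (\<Sum>n. ennreal (trans_fun_n (graph_of (X \<omega>)) n (root_of (X \<omega>)) (root_of (X \<omega>)))) \<partial>M) < \<infinity>"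
    and w: "\<And>n. (\<Sum>i\<le>n. w i (n - i)) \<le> 1"
  shows "AE \<omega> in M. total_meetings w (graph_of (X \<omega>)) (root_of (X \<omega>)) < \<infinity>"
proof -
  let ?G = "\<lambda>\<omega>. graph_of (X \<omega>)" and ?r = "\<lambda>\<omega>. root_of (X \<omega>)"
  let ?d = "\<lambda>\<omega>. of_nat (vertex_degree (?G \<omega>) (?r \<omega>)) :: ennreal"
  let ?h = "\<lambda>\<omega>. ?d \<omega> * (\<Sum>n. ennreal (trans_fun_n (?G \<omega>) n (?r \<omega>) (?r \<omega>)))"
  have [measurable]: "?d \<in> borel_measurable M"
    using measurable_compose[OF X borel_measurable_vertex_degree_root] .
  have [measurable]: "(\<lambda>\<omega>. total_meetings w (?G \<omega>) (?r \<omega>)) \<in> borel_measurable M"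
    using measurable_compose[OF X borel_measurable_total_meetings_root] .
  have "(\<integral>\<^sup>+\<omega>. ?d \<omega> * total_meetings w (?G \<omega>) (?r \<omega>) \<partial>M) =
    (\<integral>\<^sup>+\<omega>. (\<integral>\<^sup>+u. of_nat (vertex_degree (?G \<omega>) u) * meetings w (?G \<omega>) u (?r \<omega>)
       \<partial>count_space (verts (?G \<omega>))) \<partial>M)"
    unfolding unimodular_meetings[OF uni, of w, symmetric]
    by (simp add: nn_integral_cmult nn_integral_meetings_verts lf_graph_of root_of_verts)
  also have "\<dots> \<le> (\<integral>\<^sup>+\<omega>. ?h \<omega> \<partial>M)"
  proof (rule nn_integral_mono)
    fix \<omega>
    have "(\<integral>\<^sup>+u. of_nat (vertex_degree (?G \<omega>) u) * meetings w (?G \<omega>) u (?r \<omega>) \<partial>count_space (verts (?G \<omega>)))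
      \<le> (\<integral>\<^sup>+u. of_nat (vertex_degree (?G \<omega>) u) * meetings w (?G \<omega>) u (?r \<omega>) \<partial>count_space UNIV)"
      \<comment> \<open>Summing over the whole vertex type only adds nonnegative terms.\<close>
      by (subst nn_integral_count_space_indicator)
        (auto intro!: nn_integral_mono split: split_indicator)
    also have "\<dots> \<le> ?h \<omega>"
      by (rule nn_integral_degree_meetings_le[OF lf_graph_of w])
    finally show "(\<integral>\<^sup>+u. of_nat (vertex_degree (?G \<omega>) u) * meetings w (?G \<omega>) u (?r \<omega>)
        \<partial>count_space (verts (?G \<omega>))) \<le> ?h \<omega>" .
  qed
  also have "\<dots> < \<infinity>" by (rule fin)
  finally have "AE \<omega> in M. ?d \<omega> * total_meetings w (?G \<omega>) (?r \<omega>) \<noteq> \<infinity>"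
    by (intro nn_integral_PInf_AE) auto
  then show ?thesis
  proof eventually_elim
    case (elim \<omega>)
    show ?case
    \<comment> \<open>With degree 0 the product is 0 even for an infinite second factor, so
      finiteness then comes from the single weight \<open>w 0 0\<close>.\<close>
    proof (cases "vertex_degree (?G \<omega>) (?r \<omega>) = 0")
      case True
      have "w 0 0 \<le> 1" using w[of 0] by simp
      with total_meetings_degree_0[OF lf_graph_of True, of w] show ?thesis
        by (simp add: le_less_trans)
    next
      case False
      with elim show ?thesis by (auto simp: ennreal_mult_eq_top_iff less_top)
    qed
  qed
qed

text \<open>Moving from the root to other vertices needs weights that at most halve along diagonals.
  So the root estimate is applied to \<open>diag_sum w\<close>, which has this property, obeys the
  same antidiagonal bound and dominates \<open>w\<close> up to the factor 2.\<close>

lemma AE_total_meetings: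
  fixes M :: "'w measure" and X :: "'w \<Rightarrow> rooted_graph"
  assumes "X \<in> borel_measurable M" and "unimodular M X"
    and "(\<integral>\<^sup>+\<omega>. of_nat (vertex_degree (graph_of (X \<omega>)) (root_of (X \<omega>))) *
            (\<Sum>n. ennreal (trans_fun_n (graph_of (X \<omega>)) n (root_of (X \<omega>)) (root_of (X \<omega>)))) \<partial>M) < \<infinity>"
    and w: "\<And>n. (\<Sum>i\<le>n. w i (n - i)) \<le> 1"
  shows "AE \<omega> in M. \<forall>x\<in>verts (graph_of (X \<omega>)). total_meetings w (graph_of (X \<omega>)) x < \<infinity>"
  using AE_total_meetings_root[OF assms(1-3), of "diag_sum w", OF sum_diag_sum_le[of w, OF w]]
proof eventually_elim
  case (elim \<omega>)
  show ?case
  proof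
    fix x assume x: "x \<in> verts (graph_of (X \<omega>))"
    have "total_meetings w (graph_of (X \<omega>)) x \<le> 2 * total_meetings (diag_sum w) (graph_of (X \<omega>)) x"
      by (rule total_meetings_mono) (rule le_diag_sum)
    also have "total_meetings (diag_sum w) (graph_of (X \<omega>)) x < \<infinity>"
    proof (rule total_meetings_connected[OF lf_graph_of _ elim root_of_verts x])
      show "diag_sum w i j / 2 \<le> diag_sum w (Suc i) (Suc j)" for i j by simp
    qed
    then have "2 * total_meetings (diag_sum w) (graph_of (X \<omega>)) x < \<infinity>"
      by (simp add: ennreal_mult_less_top)
    finally show "total_meetings w (graph_of (X \<omega>)) x < \<infinity>" .
  qed
qed

section \<open>Discrete collisions\<close>

lemma (in finite_measure) AE_finite_events:
  assumes A [measurable]: "\<And>n. A n \<in> sets M" and fin: "(\<Sum>n. emeasure M (A n)) < \<infinity>"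
  shows "AE x in M. finite {n::nat. x \<in> A n}"
proof -
  have "AE x in M. eventually (\<lambda>n. x \<in> space M - A n) sequentially"
  proof (rule borel_cantelli_AE1)
    show "summable (\<lambda>n. measure M (A n))"
      using fin by (intro summable_suminf_not_top) (auto simp: emeasure_eq_measure)
  qed (auto simp: less_top[symmetric])
  then show ?thesis
  proof eventually_elim
    case (elim x)
    then obtain N where "\<And>n. n \<ge> N \<Longrightarrow> x \<notin> A n" by (auto simp: eventually_sequentially)
    then have "{n. x \<in> A n} \<subseteq> {..<N}" by (auto simp: not_le[symmetric])
    then show ?case by (rule finite_subset) simp
  qed
qed

text \<open>A union bound on each antidiagonal and Borel-Cantelli in \<open>n\<close> show that
  almost surely only finitely many antidiagonals are hit; each contains finitely many pairs.\<close>

lemma (in finite_measure) AE_finite_meetings: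
  assumes A [measurable]: "\<And>i j. A i j \<in> sets M"
    and le: "\<And>i j. emeasure M (A i j) \<le> w i j * meeting_prob G i j x"
    and fin: "total_meetings w G x < \<infinity>"
  shows "AE \<omega> in M. finite {(i, j). \<omega> \<in> A i j}"
proof -
  have "emeasure M (\<Union>i\<le>n. A i (n - i)) \<le> (\<Sum>i\<le>n. w i (n - i) * meeting_prob G i (n - i) x)" for n
  proof -
    have "emeasure M (\<Union>i\<le>n. A i (n - i)) \<le> (\<Sum>i\<le>n. emeasure M (A i (n - i)))"
      by (rule emeasure_subadditive_finite) auto
    also have "\<dots> \<le> (\<Sum>i\<le>n. w i (n - i) * meeting_prob G i (n - i) x)"
      by (intro sum_mono le)
    finally show ?thesis .
  qed
  then have "(\<Sum>n. emeasure M (\<Union>i\<le>n. A i (n - i))) \<le> total_meetings w G x"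
    unfolding total_meetings_eq by (intro suminf_le) auto
  with fin have "AE \<omega> in M. finite {n. \<omega> \<in> (\<Union>i\<le>n. A i (n - i))}"
    by (intro AE_finite_events) auto
  then show ?thesis
  proof eventually_elim
    case (elim \<omega>)
    let ?N = "{n. \<omega> \<in> (\<Union>i\<le>n. A i (n - i))}"
    have "{(i, j). \<omega> \<in> A i j} \<subseteq> (\<Union>n\<in>?N. (\<lambda>i. (i, n - i)) ` {..n})"
    proof clarify
      fix i j assume "\<omega> \<in> A i j"
      then have "i + j \<in> ?N" by (auto intro!: bexI[of _ i])
      moreover have "(i, j) \<in> (\<lambda>k. (k, i + j - k)) ` {..i + j}" by (rule image_eqI[of _ _ i]) auto
      ultimately show "(i, j) \<in> (\<Union>n\<in>?N. (\<lambda>i. (i, n - i)) ` {..n})" by blast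
    qed
    then show ?case by (rule finite_subset) (use elim in auto)
  qed
qed

section \<open>Marginals of the discrete walk\<close>

text \<open>The Markov property in \<open>discrete_srw\<close> fixes the whole past; here it is
  summed over all pasts that end at \<open>z\<close>.\<close>

lemma discrete_srw_step:
  fixes G :: "'v::countable graph"
  assumes X: "discrete_srw G x M X"
  shows "emeasure M {\<omega> \<in> space M. X n \<omega> = z \<and> X (Suc n) \<omega> = y} =
    emeasure M {\<omega> \<in> space M. X n \<omega> = z} * ennreal (trans_fun G z y)"
proof -
  interpret prob_space M using X by (simp add: discrete_srw_def)
  have [measurable]: "X n \<in> M \<rightarrow>\<^sub>M count_space UNIV" for n using X by (simp add: discrete_srw_def)
  \<comment> \<open>Pasts are extensional functions on \<open>{..n}\<close>: this makes them
    countably many, and different pasts give disjoint events.\<close>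
  define S where "S = {s \<in> PiE {..n} (\<lambda>_. UNIV). s n = z}"
  define A where "A s = {\<omega> \<in> space M. \<forall>i\<le>n. X i \<omega> = s i}" for s
  define B where "B s = {\<omega> \<in> space M. (\<forall>i\<le>n. X i \<omega> = s i) \<and> X (Suc n) \<omega> = y}" for s
  have S: "countable S"
    by (rule countable_subset[of _ "PiE {..n} (\<lambda>_. UNIV)"]) (auto simp: S_def intro: countable_PiE)
  have [measurable]: "A s \<in> sets M" "B s \<in> sets M" for s unfolding A_def B_def by measurable
  have path: "restrict (\<lambda>i. X i \<omega>) {..n} \<in> S" if "X n \<omega> = z" for \<omega>
    using that by (auto simp: S_def)
  have eqs: "s = s'" if "s \<in> S" "s' \<in> S" "\<omega> \<in> A s" "\<omega> \<in> A s'" for s s' \<omega>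
    using that unfolding S_def A_def by (intro PiE_ext[of s "{..n}" "\<lambda>_. UNIV" s']) auto
  have sub: "B s \<subseteq> A s" for s by (auto simp: A_def B_def)
  have disj: "disjoint_family_on A S" "disjoint_family_on B S"
    using eqs sub unfolding disjoint_family_on_def by blast+
  have "{\<omega> \<in> space M. X n \<omega> = z} = \<Union> (A ` S)"
  proof (intro set_eqI iffI)
    fix \<omega> assume w: "\<omega> \<in> {\<omega> \<in> space M. X n \<omega> = z}"
    then have "\<omega> \<in> A (restrict (\<lambda>i. X i \<omega>) {..n})" by (auto simp: A_def)
    with path w show "\<omega> \<in> \<Union> (A ` S)" by blast
  qed (auto simp: A_def S_def)
  then have eqA: "emeasure M {\<omega> \<in> space M. X n \<omega> = z} = (\<integral>\<^sup>+s. emeasure M (A s) \<partial>count_space S)"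
    using emeasure_UN_countable[OF _ S disj(1), of M] by simp
  have "{\<omega> \<in> space M. X n \<omega> = z \<and> X (Suc n) \<omega> = y} = \<Union> (B ` S)"
  proof (intro set_eqI iffI)
    fix \<omega> assume w: "\<omega> \<in> {\<omega> \<in> space M. X n \<omega> = z \<and> X (Suc n) \<omega> = y}"
    then have "\<omega> \<in> B (restrict (\<lambda>i. X i \<omega>) {..n})" by (auto simp: B_def)
    with path w show "\<omega> \<in> \<Union> (B ` S)" by blast
  qed (auto simp: B_def S_def)
  then have "emeasure M {\<omega> \<in> space M. X n \<omega> = z \<and> X (Suc n) \<omega> = y} = (\<integral>\<^sup>+s. emeasure M (B s) \<partial>count_space S)"
    using emeasure_UN_countable[OF _ S disj(2), of M] by simp
  also have "\<dots> = (\<integral>\<^sup>+s. emeasure M (A s) * ennreal (trans_fun G z y) \<partial>count_space S)"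
  proof (rule nn_integral_cong)
    fix s assume "s \<in> space (count_space S)"
    then have "measure M (B s) = measure M (A s) * trans_fun G z y"
      using X by (auto simp: discrete_srw_def A_def B_def S_def)
    then show "emeasure M (B s) = emeasure M (A s) * ennreal (trans_fun G z y)"
      by (simp add: emeasure_eq_measure ennreal_mult trans_fun_nonneg)
  qed
  also have "\<dots> = emeasure M {\<omega> \<in> space M. X n \<omega> = z} * ennreal (trans_fun G z y)"
    by (simp add: eqA nn_integral_multc)
  finally show ?thesis .
qed

lemma discrete_srw_marginal:
  fixes G :: "'v::countable graph"
  assumes G: "lf_graph G" and X: "discrete_srw G x M X"
  shows "emeasure M {\<omega> \<in> space M. X n \<omega> = y} = ennreal (trans_fun_n G n x y)"
proof (induction n arbitrary: y)
  case 0
  interpret prob_space M using X by (simp add: discrete_srw_def)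
  have [measurable]: "X 0 \<in> M \<rightarrow>\<^sub>M count_space UNIV" using X by (simp add: discrete_srw_def)
  have x: "AE \<omega> in M. X 0 \<omega> = x" using X by (simp add: discrete_srw_def)
  show ?case
  proof (cases "x = y")
    case True
    then show ?thesis using x by (simp add: emeasure_eq_1_AE)
  next
    case False
    then have "emeasure M {\<omega> \<in> space M. X 0 \<omega> = y} = emeasure M {}"
      using x by (intro emeasure_eq_AE) auto
    with False show ?thesis by simp
  qed
next
  case (Suc n)
  have [measurable]: "X n \<in> M \<rightarrow>\<^sub>M count_space UNIV" for n using X by (simp add: discrete_srw_def)
  have "{\<omega> \<in> space M. X (Suc n) \<omega> = y} = (\<Union>z. {\<omega> \<in> space M. X n \<omega> = z \<and> X (Suc n) \<omega> = y})"
    by auto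
  then have "emeasure M {\<omega> \<in> space M. X (Suc n) \<omega> = y} =
      (\<integral>\<^sup>+z. emeasure M {\<omega> \<in> space M. X n \<omega> = z \<and> X (Suc n) \<omega> = y} \<partial>count_space UNIV)"
    by (simp only:) (rule emeasure_UN_countable, auto simp: disjoint_family_on_def)
  also have "\<dots> = (\<integral>\<^sup>+z. ennreal (trans_fun_n G n x z) * ennreal (trans_fun_n G 1 z y) \<partial>count_space UNIV)"
    unfolding discrete_srw_step[OF X] Suc trans_fun_n_1[OF G] ..
  \<comment> \<open>The induction peels off the last step, the recursion of
    \<open>trans_fun_n\<close> the first one.\<close>
  also have "\<dots> = ennreal (trans_fun_n G (Suc n) x y)"
    using trans_fun_n_add[OF G, of n 1 x y] by simp
  finally show ?case .
qed

lemma space_srw_law: "srw_law G x \<mu> \<Longrightarrow> space \<mu> = UNIV"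
  unfolding srw_law_def by (auto simp: space_PiM dest: sets_eq_imp_space_eq)

lemma prob_space_srw_law: "srw_law G x \<mu> \<Longrightarrow> prob_space \<mu>"
  by (simp add: srw_law_def discrete_srw_def)

lemma measurable_srw_law: "srw_law G x \<mu> \<Longrightarrow> (\<lambda>Z. Z n) \<in> \<mu> \<rightarrow>\<^sub>M count_space UNIV"
  by (simp add: srw_law_def discrete_srw_def)

lemma pred_eq_countable [measurable (raw)]:
  fixes f g :: "'a \<Rightarrow> 'v::countable"
  assumes [measurable]: "f \<in> M \<rightarrow>\<^sub>M count_space UNIV" "g \<in> M \<rightarrow>\<^sub>M count_space UNIV"
  shows "Measurable.pred M (\<lambda>x. f x = g x)"
proof -
  have "Measurable.pred M (\<lambda>x. \<exists>v. f x = v \<and> g x = v)" by measurable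
  then show ?thesis by simp
qed

text \<open>Split the event by the common vertex \<open>v\<close>; each piece is a rectangle, whose
  product measure is the product of the marginals.\<close>

lemma srw_law_meeting:
  fixes G :: "'v::countable graph"
  assumes G: "lf_graph G" and \<mu>: "srw_law G x \<mu>"
  shows "emeasure (\<mu> \<Otimes>\<^sub>M \<mu>) {\<omega> \<in> space (\<mu> \<Otimes>\<^sub>M \<mu>). fst \<omega> i = snd \<omega> j} = meeting_prob G i j x"
proof -
  interpret prob_space \<mu> by (rule prob_space_srw_law[OF \<mu>])
  note [measurable] = measurable_srw_law[OF \<mu>]
  have marg: "emeasure \<mu> {Z. Z n = v} = ennreal (trans_fun_n G n x v)" for n v
    using discrete_srw_marginal[OF G, of x \<mu> "\<lambda>n Z. Z n" n v] \<mu>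
    by (simp add: srw_law_def space_srw_law[OF \<mu>])
  have sets: "{Z. Z n = v} \<in> sets \<mu>" for n v
    using measurable_sets_Collect[OF measurable_srw_law[OF \<mu>], of "\<lambda>y. y = v" n]
    by (simp add: space_srw_law[OF \<mu>])
  have "{\<omega> \<in> space (\<mu> \<Otimes>\<^sub>M \<mu>). fst \<omega> i = snd \<omega> j} = (\<Union>v. {Z. Z i = v} \<times> {Z. Z j = v})"
    by (auto simp: space_pair_measure space_srw_law[OF \<mu>])
  then have "emeasure (\<mu> \<Otimes>\<^sub>M \<mu>) {\<omega> \<in> space (\<mu> \<Otimes>\<^sub>M \<mu>). fst \<omega> i = snd \<omega> j} =
      (\<integral>\<^sup>+v. emeasure (\<mu> \<Otimes>\<^sub>M \<mu>) ({Z. Z i = v} \<times> {Z. Z j = v}) \<partial>count_space UNIV)"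
    by (simp only:) (rule emeasure_UN_countable, auto simp: disjoint_family_on_def sets)
  also have "\<dots> = meeting_prob G i j x"
    by (simp add: meeting_prob_def emeasure_pair_measure_Times sets marg)
  finally show ?thesis .
qed

lemma discrete_finite_collisionI:
  fixes G :: "'v::countable graph"
  assumes G: "lf_graph G"
    and fin: "\<And>x. x \<in> verts G \<Longrightarrow> total_meetings (\<lambda>i j. if i = j then 1 else 0) G x < \<infinity>"
  shows "discrete_finite_collision G"
  unfolding discrete_finite_collision_def
proof (intro ballI allI impI)
  fix x \<mu> assume x: "x \<in> verts G" and \<mu>: "srw_law G x \<mu>"
  interpret prob_space \<mu> by (rule prob_space_srw_law[OF \<mu>])
  interpret pair_prob_space \<mu> \<mu> ..
  note [measurable] = measurable_srw_law[OF \<mu>]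
  \<comment> \<open>Off the diagonal the events are empty, so the pairs that occur correspond to
    collision times.\<close>
  define A where "A i j = (if i = j then {\<omega> \<in> space (\<mu> \<Otimes>\<^sub>M \<mu>). fst \<omega> i = snd \<omega> j} else {})" for i j :: nat
  have "AE \<omega> in \<mu> \<Otimes>\<^sub>M \<mu>. finite {(i, j). \<omega> \<in> A i j}"
  proof (rule P.AE_finite_meetings[OF _ _ fin[OF x]])
    show "A i j \<in> sets (\<mu> \<Otimes>\<^sub>M \<mu>)" for i j
      unfolding A_def by (cases "i = j") (simp_all, measurable)
    show "emeasure (\<mu> \<Otimes>\<^sub>M \<mu>) (A i j) \<le> (if i = j then 1 else 0) * meeting_prob G i j x" for i j
      by (cases "i = j") (simp_all add: A_def srw_law_meeting[OF G \<mu>])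
  qed
  then show "AE (X, Y) in \<mu> \<Otimes>\<^sub>M \<mu>. finite {n. X n = Y n}"
  proof eventually_elim
    case (elim \<omega>)
    have "{n. fst \<omega> n = snd \<omega> n} \<subseteq> fst ` {(i, j). \<omega> \<in> A i j}"
    proof
      fix n assume "n \<in> {n. fst \<omega> n = snd \<omega> n}"
      then have "(n, n) \<in> {(i, j). \<omega> \<in> A i j}"
        by (auto simp: A_def space_pair_measure space_srw_law[OF \<mu>])
      then show "n \<in> fst ` {(i, j). \<omega> \<in> A i j}" by (rule image_eqI[rotated]) simp
    qed
    with elim have "finite {n. fst \<omega> n = snd \<omega> n}" by (meson finite_imageI finite_subset)
    then show ?case by (simp add: split_beta)
  qed
qed

text \<open>Only \<open>i = n div 2\<close> can satisfy \<open>i = n - i\<close>.\<close>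

lemma sum_diagonal_weight_le: "(\<Sum>i\<le>n. if i = n - i then 1 else 0) \<le> (1::ennreal)" for n :: nat
proof -
  have "(\<Sum>i\<le>n. if i = n - i then 1 else 0) \<le> (\<Sum>i\<le>n. if i = n div 2 then 1 else (0::ennreal))"
    by (intro sum_mono) auto
  also have "\<dots> \<le> 1" by simp
  finally show ?thesis .
qed

section \<open>Continuous collisions\<close>

definition holding_law :: "(nat \<Rightarrow> real) measure" where
  "holding_law = (\<Pi>\<^sub>M k\<in>UNIV. density lborel (exponential_density 1))"

text \<open>\<open>clock \<xi> k\<close> is the time at which the walk with holding times \<open>\<xi>\<close> has made \<open>k\<close> jumps.\<close>

definition clock :: "(nat \<Rightarrow> real) \<Rightarrow> nat \<Rightarrow> real" where
  "clock \<xi> k = (\<Sum>i<k. \<xi> i)"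

text \<open>The level \<open>T\<close> is a natural number, which keeps the quantifiers countable
  and the predicate measurable.\<close>

definition nonexplosive :: "(nat \<Rightarrow> real) \<Rightarrow> bool" where
  "nonexplosive \<xi> \<longleftrightarrow> (\<forall>k. 0 < \<xi> k) \<and> (\<forall>T::nat. \<exists>k. real T < clock \<xi> k)"

definition jump_count :: "(nat \<Rightarrow> real) \<Rightarrow> real \<Rightarrow> nat" where
  "jump_count \<xi> t = card {k. (\<Sum>i\<le>k. \<xi> i) \<le> t}"

section \<open>Jump counts, left limits and collision times of fixed paths\<close>

lemma sum_atMost_eq_clock: "(\<Sum>i\<le>k. \<xi> i) = clock \<xi> (Suc k)"
  by (simp add: clock_def lessThan_Suc_atMost)

lemma clock_mono: "(\<And>k. 0 < \<xi> k) \<Longrightarrow> i \<le> j \<Longrightarrow> clock \<xi> i \<le> clock \<xi> j"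
  unfolding clock_def by (intro sum_mono2) (auto intro: less_imp_le)

text \<open>The jump times increase and are unbounded, so those up to \<open>t\<close> form a finite
  initial segment. In particular \<open>jump_count\<close> is not the default cardinality 0 of an
  infinite set.\<close>

lemma jump_times_le:
  assumes "nonexplosive \<xi>"
  shows "{k. clock \<xi> (Suc k) \<le> t} = {..<jump_count \<xi> t}"
proof -
  have pos: "\<And>k. 0 < \<xi> k" using assms by (simp add: nonexplosive_def)
  obtain T :: nat where "t \<le> real T" using real_arch_simple by blast
  moreover obtain k where "real T < clock \<xi> k" using assms by (auto simp: nonexplosive_def)
  moreover have "clock \<xi> k \<le> clock \<xi> (Suc k)" by (rule clock_mono[OF pos]) simp
  ultimately have ex: "t < clock \<xi> (Suc k)" by linarith
  define n where "n = (LEAST k. t < clock \<xi> (Suc k))"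
  have n: "t < clock \<xi> (Suc n)" unfolding n_def using ex by (rule LeastI)
  have "clock \<xi> (Suc k) \<le> t \<longleftrightarrow> k < n" for k
  proof
    assume le: "clock \<xi> (Suc k) \<le> t"
    show "k < n"
    proof (rule ccontr)
      assume "\<not> k < n"
      then have "clock \<xi> (Suc n) \<le> clock \<xi> (Suc k)" by (intro clock_mono[OF pos]) simp
      with n le show False by linarith
    qed
  next
    assume "k < n"
    then show "clock \<xi> (Suc k) \<le> t" unfolding n_def by (meson not_less_Least not_less)
  qed
  then have "{k. clock \<xi> (Suc k) \<le> t} = {..<n}" by auto
  then show ?thesis by (simp add: jump_count_def sum_atMost_eq_clock)
qed

lemma clock_jump_count:
  assumes "nonexplosive \<xi>" "0 \<le> t"
  shows "clock \<xi> (jump_count \<xi> t) \<le> t" "t < clock \<xi> (Suc (jump_count \<xi> t))"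
proof -
  note eq = jump_times_le[OF assms(1), of t]
  show "clock \<xi> (jump_count \<xi> t) \<le> t"
  proof (cases "jump_count \<xi> t")
    case 0
    then show ?thesis using assms(2) by (simp add: clock_def)
  next
    case (Suc m)
    then have "m \<in> {k. clock \<xi> (Suc k) \<le> t}" unfolding eq by simp
    with Suc show ?thesis by simp
  qed
  have "jump_count \<xi> t \<notin> {k. clock \<xi> (Suc k) \<le> t}" unfolding eq by simp
  then show "t < clock \<xi> (Suc (jump_count \<xi> t))" by simp
qed

lemma ctime_path_jump_count: "ctime_path (Z, \<xi>) t = Z (jump_count \<xi> t)"
  by (simp add: ctime_path_def jump_count_def)

lemma left_limit_no_jump:
  assumes \<xi>: "nonexplosive \<xi>" and no_jump: "\<And>k. clock \<xi> (Suc k) \<noteq> t"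
  shows "left_limit (ctime_path (Z, \<xi>)) t = ctime_path (Z, \<xi>) t"
proof -
  define n where "n = jump_count \<xi> t"
  have iff: "clock \<xi> (Suc k) \<le> t \<longleftrightarrow> k < n" for k
    using jump_times_le[OF \<xi>, of t] by (auto simp: n_def)
  have pos: "\<And>k. 0 < \<xi> k" using \<xi> by (simp add: nonexplosive_def)
  \<comment> \<open>The last jump time before \<open>t\<close>, or an arbitrary earlier time if
    there was no jump; on the interval from \<open>a\<close> to \<open>t\<close> the jump count is
    constant.\<close>
  define a where "a = (if n = 0 then t - 1 else clock \<xi> n)"
  have "a < t"
    using iff[of "n - 1"] no_jump[of "n - 1"] by (auto simp: a_def)
  have "jump_count \<xi> s = n" if s: "a < s" "s < t" for s
  proof -
    have "clock \<xi> (Suc k) \<le> s \<longleftrightarrow> k < n" for k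
    proof
      assume "clock \<xi> (Suc k) \<le> s"
      with s have "clock \<xi> (Suc k) \<le> t" by linarith
      then show "k < n" by (simp only: iff)
    next
      assume k: "k < n"
      then have "clock \<xi> (Suc k) \<le> clock \<xi> n" by (intro clock_mono[OF pos]) simp
      with k s show "clock \<xi> (Suc k) \<le> s" by (auto simp: a_def)
    qed
    then have "{k. clock \<xi> (Suc k) \<le> s} = {..<n}" by auto
    then show ?thesis by (simp add: jump_count_def sum_atMost_eq_clock)
  qed
  then have ev: "eventually (\<lambda>s. ctime_path (Z, \<xi>) s = ctime_path (Z, \<xi>) t) (at_left t)"
    unfolding eventually_at_left[OF \<open>a < t\<close>] ctime_path_jump_count n_def[symmetric]
    using \<open>a < t\<close> by (intro exI[of _ a]) auto
  show ?thesis unfolding left_limit_def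
  proof (rule the_equality)
    show "eventually (\<lambda>s. ctime_path (Z, \<xi>) s = ctime_path (Z, \<xi>) t) (at_left t)" by (rule ev)
  next
    fix v assume "eventually (\<lambda>s. ctime_path (Z, \<xi>) s = v) (at_left t)"
    \<comment> \<open>Two values that are both eventually attained to the left of \<open>t\<close>
      are attained at a common time, hence equal.\<close>
    from eventually_happens'[OF trivial_limit_at_left_real eventually_conj[OF ev this]]
    show "v = ctime_path (Z, \<xi>) t" by metis
  qed
qed

text \<open>The first walk stands after \<open>i\<close> jumps at some time when the second one stands after \<open>j\<close>.\<close>

definition overlap :: "nat \<Rightarrow> nat \<Rightarrow> (nat \<Rightarrow> real) \<Rightarrow> (nat \<Rightarrow> real) \<Rightarrow> bool" where
  "overlap i j \<xi> \<eta> \<longleftrightarrow> (\<forall>k. 0 < \<xi> k) \<and> (\<forall>k. 0 < \<eta> k) \<and>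
     clock \<xi> i < clock \<eta> (Suc j) \<and> clock \<eta> j < clock \<xi> (Suc i)"

text \<open>A collision time is determined by its pair of jump counts, and that pair is one of the
  finitely many overlapping pairs with \<open>Z i = W j\<close>.\<close>

lemma finite_collision_times:
  assumes \<xi>: "nonexplosive \<xi>" and \<eta>: "nonexplosive \<eta>"
    and fin: "finite {(i, j). Z i = W j \<and> overlap i j \<xi> \<eta>}"
  shows "finite {t. t \<ge> 0 \<and> left_limit (ctime_path (Z, \<xi>)) t \<noteq> left_limit (ctime_path (W, \<eta>)) t \<and>
                    ctime_path (Z, \<xi>) t = ctime_path (W, \<eta>) t}" (is "finite ?C")
proof -
  let ?f = "\<lambda>t. (jump_count \<xi> t, jump_count \<eta> t)"
  have jump: "jump_count \<zeta> s < jump_count \<zeta> t"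
    if \<zeta>: "nonexplosive \<zeta>" and "s < t" and k: "clock \<zeta> (Suc k) = t" for \<zeta> s t k
  proof -
    have "k \<notin> {k. clock \<zeta> (Suc k) \<le> s}" "k \<in> {k. clock \<zeta> (Suc k) \<le> t}" using that by auto
    then show ?thesis unfolding jump_times_le[OF \<zeta>] by simp
  qed
  have "inj_on ?f ?C"
  proof (rule linorder_inj_onI')
    fix s t assume t: "t \<in> ?C" and st: "s < t"
    \<comment> \<open>Without a jump at \<open>t\<close> both left limits equal the values at
      \<open>t\<close>, which coincide, against the choice of \<open>t\<close>. The jump raises one
      count strictly above its value at \<open>s\<close>.\<close>
    have "(\<exists>k. clock \<xi> (Suc k) = t) \<or> (\<exists>k. clock \<eta> (Suc k) = t)"
    proof (rule ccontr)
      assume "\<not> ?thesis"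
      then have "left_limit (ctime_path (Z, \<xi>)) t = ctime_path (Z, \<xi>) t"
        "left_limit (ctime_path (W, \<eta>)) t = ctime_path (W, \<eta>) t"
        by (auto intro: left_limit_no_jump \<xi> \<eta>)
      with t show False by simp
    qed
    with jump[OF \<xi> st] jump[OF \<eta> st] show "?f s \<noteq> ?f t" by fastforce
  qed
  moreover have "?f ` ?C \<subseteq> {(i, j). Z i = W j \<and> overlap i j \<xi> \<eta>}"
  proof clarify
    fix t :: real assume t: "0 \<le> t" and eq: "ctime_path (Z, \<xi>) t = ctime_path (W, \<eta>) t"
    have "\<forall>k. 0 < \<xi> k" "\<forall>k. 0 < \<eta> k" using \<xi> \<eta> by (auto simp: nonexplosive_def)
    with clock_jump_count[OF \<xi> t] clock_jump_count[OF \<eta> t]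
    have "overlap (jump_count \<xi> t) (jump_count \<eta> t) \<xi> \<eta>" by (auto simp: overlap_def)
    with eq show "Z (jump_count \<xi> t) = W (jump_count \<eta> t) \<and> overlap (jump_count \<xi> t) (jump_count \<eta> t) \<xi> \<eta>"
      by (simp add: ctime_path_jump_count)
  qed
  ultimately show ?thesis using fin by (meson finite_imageD finite_subset)
qed

text \<open>If \<open>k < k'\<close> then \<open>l' < l\<close>, and the chain \<open>clock \<eta> l
  < clock \<xi> (Suc k) \<le> clock \<xi> k' < clock \<eta> (Suc l') \<le> clock \<eta> l\<close> is
  contradictory.\<close>

lemma overlap_antidiagonal:
  assumes "overlap i j \<xi> \<eta>" "overlap i' j' \<xi> \<eta>" "i + j = i' + j'"
  shows "i = i'"
proof -
  have "\<not> k < k'" if "overlap k l \<xi> \<eta>" "overlap k' l' \<xi> \<eta>" "k + l = k' + l'" for k k' l l'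
  proof
    assume "k < k'"
    then have "Suc k \<le> k'" "Suc l' \<le> l" using that by auto
    moreover have pos: "\<And>k. 0 < \<xi> k" "\<And>k. 0 < \<eta> k" using that by (auto simp: overlap_def)
    ultimately have "clock \<xi> (Suc k) \<le> clock \<xi> k'" "clock \<eta> (Suc l') \<le> clock \<eta> l"
      by (auto intro: clock_mono)
    with that show False by (auto simp: overlap_def)
  qed
  from this[OF assms] this[OF assms(2,1)] assms(3) show ?thesis by simp
qed

section \<open>Exponential holding times and overlap probabilities\<close>

lemma prob_space_exponential: "prob_space (density lborel (exponential_density 1))"
  by (rule prob_space_exponential_density) simp

lemma prob_space_holding_law: "prob_space holding_law"
  unfolding holding_law_def by (rule prob_space_PiM) (rule prob_space_exponential)

lemma borel_measurable_holding_time [measurable]: "(\<lambda>\<xi>. \<xi> k) \<in> borel_measurable holding_law"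
proof -
  have "(\<lambda>\<xi>. \<xi> k) \<in> holding_law \<rightarrow>\<^sub>M density lborel (exponential_density 1)"
    unfolding holding_law_def by (rule measurable_component_singleton) simp
  also have "\<dots> = borel_measurable holding_law" by (rule measurable_cong_sets) auto
  finally show ?thesis .
qed

lemma borel_measurable_clock [measurable]: "(\<lambda>\<xi>. clock \<xi> k) \<in> borel_measurable holding_law"
  unfolding clock_def by measurable

lemma pred_nonexplosive [measurable]: "Measurable.pred holding_law nonexplosive"
  unfolding nonexplosive_def by measurable

lemma pred_overlap [measurable (raw)]:
  assumes [measurable]: "f \<in> N \<rightarrow>\<^sub>M holding_law" "g \<in> N \<rightarrow>\<^sub>M holding_law"
  shows "Measurable.pred N (\<lambda>x. overlap i j (f x) (g x))"
  unfolding overlap_def by measurable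

lemma AE_holding_time_pos: "AE \<xi> in holding_law. \<forall>k. 0 < \<xi> k"
proof -
  have "AE x in density lborel (exponential_density 1). 0 < (x::real)"
    \<comment> \<open>The density vanishes on negative numbers, and the remaining point 0 is a
      Lebesgue null set.\<close>
    by (subst AE_density) (auto intro!: AE_I'[of "{0}"] simp: exponential_density_def not_less)
  then have "AE \<xi> in holding_law. 0 < \<xi> k" for k
    unfolding holding_law_def
    by (intro AE_PiM_component[of UNIV "\<lambda>_. density lborel (exponential_density 1)" k] prob_space_exponential) auto
  then show ?thesis by (simp add: AE_all_countable)
qed

text \<open>Almost surely some single holding time exceeds \<open>T\<close>: the probability that
  the first \<open>n\<close> are all at most \<open>T\<close> is \<open>q ^ n\<close> with
  \<open>q < 1\<close>, which is summable in \<open>n\<close>.\<close>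

lemma AE_nonexplosive: "AE \<xi> in holding_law. nonexplosive \<xi>"
proof -
  interpret prob_space holding_law by (rule prob_space_holding_law)
  have "AE \<xi> in holding_law. finite {n. \<xi> \<in> {\<xi> \<in> space holding_law. \<forall>k<n. \<xi> k \<le> real T}}" for T :: nat
  proof (rule AE_finite_events)
    fix n
    show "{\<xi> \<in> space holding_law. \<forall>k<n. \<xi> k \<le> real T} \<in> events" by measurable
  next
    let ?D = "density lborel (exponential_density 1)"
    define q where "q = 1 - exp (- real T)"
    have q: "emeasure ?D {..real T} = ennreal q"
      by (subst emeasure_erlang_density) (auto simp: erlang_CDF_def q_def)
    \<comment> \<open>Only the first \<open>n\<close> coordinates are constrained, so this is a
      cylinder and its probability is a product.\<close>
    have "{\<xi> \<in> space holding_law. \<forall>k<n. \<xi> k \<le> real T} =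
        prod_emb UNIV (\<lambda>_. ?D) {..<n} (PiE {..<n} (\<lambda>_. {..real T}))" for n
      by (intro set_eqI) (simp add: prod_emb_def holding_law_def space_PiM PiE_iff Ball_def)
    then have "emeasure holding_law {\<xi> \<in> space holding_law. \<forall>k<n. \<xi> k \<le> real T} = ennreal (q ^ n)" for n
      unfolding holding_law_def
      by (simp add: emeasure_PiM_emb prob_space_exponential q ennreal_power q_def)
    moreover have "0 \<le> q" "q < 1" by (auto simp: q_def)
    moreover from this have "summable (\<lambda>n. q ^ n)" by (intro summable_geometric) auto
    ultimately show "(\<Sum>n. emeasure holding_law {\<xi> \<in> space holding_law. \<forall>k<n. \<xi> k \<le> real T}) < \<infinity>"
      by (simp add: suminf_ennreal2)
  qed
  then have "AE \<xi> in holding_law. \<forall>T::nat. finite {n. \<xi> \<in> {\<xi> \<in> space holding_law. \<forall>k<n. \<xi> k \<le> real T}}"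
    by (simp add: AE_all_countable)
  with AE_holding_time_pos AE_space show ?thesis
  proof eventually_elim
    case (elim \<xi>)
    have "\<exists>k. real T < clock \<xi> k" for T :: nat
    proof -
      have "finite {n. \<forall>k<n. \<xi> k \<le> real T}" using elim by simp
      then have "{n. \<forall>k<n. \<xi> k \<le> real T} \<noteq> UNIV" by (metis infinite_UNIV_nat)
      then obtain n where "\<not> (\<forall>k<n. \<xi> k \<le> real T)" by blast
      then obtain k where "real T < \<xi> k" by (auto simp: not_le)
      moreover have "0 \<le> clock \<xi> k" unfolding clock_def by (rule sum_nonneg) (use elim in \<open>simp add: less_imp_le\<close>)
      ultimately have "real T < clock \<xi> (Suc k)" by (simp add: clock_def)
      then show ?thesis ..
    qed
    with elim show ?case by (simp add: nonexplosive_def)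
  qed
qed

definition overlap_prob :: "nat \<Rightarrow> nat \<Rightarrow> ennreal" where
  "overlap_prob i j = (\<integral>\<^sup>+\<xi>. (\<integral>\<^sup>+\<eta>. (if overlap i j \<xi> \<eta> then 1 else 0) \<partial>holding_law) \<partial>holding_law)"

text \<open>The pairs of jump counts that occur form a lattice path, which meets each antidiagonal at most once.\<close>

lemma sum_overlap_prob_le: "(\<Sum>i\<le>n. overlap_prob i (n - i)) \<le> 1"
proof -
  interpret prob_space holding_law by (rule prob_space_holding_law)
  have "(\<Sum>i\<le>n. overlap_prob i (n - i)) =
      (\<integral>\<^sup>+\<xi>. (\<Sum>i\<le>n. (\<integral>\<^sup>+\<eta>. (if overlap i (n - i) \<xi> \<eta> then 1 else 0) \<partial>holding_law)) \<partial>holding_law)"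
    unfolding overlap_prob_def by (rule nn_integral_sum[symmetric]) measurable
  also have "\<dots> = (\<integral>\<^sup>+\<xi>. (\<integral>\<^sup>+\<eta>. (\<Sum>i\<le>n. (if overlap i (n - i) \<xi> \<eta> then 1 else 0)) \<partial>holding_law) \<partial>holding_law)"
    by (intro nn_integral_cong nn_integral_sum[symmetric]) measurable
  also have "\<dots> \<le> (\<integral>\<^sup>+\<xi>. (\<integral>\<^sup>+\<eta>. 1 \<partial>holding_law) \<partial>holding_law)"
  proof (intro nn_integral_mono)
    fix \<xi> \<eta>
    show "(\<Sum>i\<le>n. (if overlap i (n - i) \<xi> \<eta> then 1 else 0)) \<le> (1::ennreal)"
    proof (cases "\<exists>k\<le>n. overlap k (n - k) \<xi> \<eta>")
      case True
      then obtain k where "k \<le> n" "overlap k (n - k) \<xi> \<eta>" by blast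
      then have only: "i = k" if "i \<le> n" "overlap i (n - i) \<xi> \<eta>" for i
        using overlap_antidiagonal[of i "n - i" \<xi> \<eta> k "n - k"] that by simp
      have "(\<Sum>i\<le>n. (if overlap i (n - i) \<xi> \<eta> then 1 else 0)) \<le> (\<Sum>i\<le>n. if i = k then 1 else (0::ennreal))"
      proof (rule sum_mono)
        fix i assume "i \<in> {..n}"
        with only[of i] show "(if overlap i (n - i) \<xi> \<eta> then 1 else 0) \<le> (if i = k then 1 else (0::ennreal))"
          by (cases "i = k") auto
      qed
      also have "\<dots> \<le> 1" by simp
      finally show ?thesis .
    next
      case False
      then have "(\<Sum>i\<le>n. (if overlap i (n - i) \<xi> \<eta> then 1 else 0)) = (0::ennreal)"
        by (intro sum.neutral) auto
      then show ?thesis by simp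
    qed
  qed
  also have "\<dots> = 1" by (simp add: emeasure_space_1)
  finally show ?thesis .
qed

section \<open>Collisions of two independent continuous-time walks\<close>

text \<open>Each walk is a pair of a path and its holding times. Fubini regroups two such pairs into
  the two paths and the two clocks.\<close>

lemma nn_integral_pair_pair_mult:
  assumes M: "sigma_finite_measure M" and N: "sigma_finite_measure N"
    and f [measurable]: "f \<in> borel_measurable (M \<Otimes>\<^sub>M M)" and g [measurable]: "g \<in> borel_measurable (N \<Otimes>\<^sub>M N)"
  shows "(\<integral>\<^sup>+\<omega>. f (fst (fst \<omega>), fst (snd \<omega>)) * g (snd (fst \<omega>), snd (snd \<omega>)) \<partial>((M \<Otimes>\<^sub>M N) \<Otimes>\<^sub>M (M \<Otimes>\<^sub>M N))) =
    (\<integral>\<^sup>+z. f z \<partial>(M \<Otimes>\<^sub>M M)) * (\<integral>\<^sup>+z. g z \<partial>(N \<Otimes>\<^sub>M N))"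
proof -
  interpret M: sigma_finite_measure M by (rule M)
  interpret N: sigma_finite_measure N by (rule N)
  interpret MN: pair_sigma_finite M N ..
  have "(\<integral>\<^sup>+\<omega>. f (fst (fst \<omega>), fst (snd \<omega>)) * g (snd (fst \<omega>), snd (snd \<omega>)) \<partial>((M \<Otimes>\<^sub>M N) \<Otimes>\<^sub>M (M \<Otimes>\<^sub>M N))) =
    (\<integral>\<^sup>+a. (\<integral>\<^sup>+b. f (fst a, fst b) * g (snd a, snd b) \<partial>(M \<Otimes>\<^sub>M N)) \<partial>(M \<Otimes>\<^sub>M N))"
    by (subst MN.P.nn_integral_fst[symmetric]) simp_all
  also have "\<dots> = (\<integral>\<^sup>+a. (\<integral>\<^sup>+W. f (fst a, W) \<partial>M) * (\<integral>\<^sup>+\<eta>. g (snd a, \<eta>) \<partial>N) \<partial>(M \<Otimes>\<^sub>M N))"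
  proof (rule nn_integral_cong)
    fix a assume "a \<in> space (M \<Otimes>\<^sub>M N)"
    then have a [measurable]: "fst a \<in> space M" "snd a \<in> space N" by (auto simp: space_pair_measure)
    have "(\<integral>\<^sup>+b. f (fst a, fst b) * g (snd a, snd b) \<partial>(M \<Otimes>\<^sub>M N)) =
        (\<integral>\<^sup>+W. (\<integral>\<^sup>+\<eta>. f (fst a, W) * g (snd a, \<eta>) \<partial>N) \<partial>M)"
      by (subst N.nn_integral_fst[symmetric]) simp_all
    also have "\<dots> = (\<integral>\<^sup>+W. f (fst a, W) \<partial>M) * (\<integral>\<^sup>+\<eta>. g (snd a, \<eta>) \<partial>N)"
      by (simp add: nn_integral_cmult nn_integral_multc)
    finally show "(\<integral>\<^sup>+b. f (fst a, fst b) * g (snd a, snd b) \<partial>(M \<Otimes>\<^sub>M N)) =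
        (\<integral>\<^sup>+W. f (fst a, W) \<partial>M) * (\<integral>\<^sup>+\<eta>. g (snd a, \<eta>) \<partial>N)" .
  qed
  also have "\<dots> = (\<integral>\<^sup>+Z. (\<integral>\<^sup>+\<xi>. (\<integral>\<^sup>+W. f (Z, W) \<partial>M) * (\<integral>\<^sup>+\<eta>. g (\<xi>, \<eta>) \<partial>N) \<partial>N) \<partial>M)"
    by (subst N.nn_integral_fst[symmetric]) simp_all
  also have "\<dots> = (\<integral>\<^sup>+Z. (\<integral>\<^sup>+W. f (Z, W) \<partial>M) \<partial>M) * (\<integral>\<^sup>+\<xi>. (\<integral>\<^sup>+\<eta>. g (\<xi>, \<eta>) \<partial>N) \<partial>N)"
    by (simp add: nn_integral_cmult nn_integral_multc)
  also have "\<dots> = (\<integral>\<^sup>+z. f z \<partial>(M \<Otimes>\<^sub>M M)) * (\<integral>\<^sup>+z. g z \<partial>(N \<Otimes>\<^sub>M N))"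
    by (simp add: M.nn_integral_fst N.nn_integral_fst)
  finally show ?thesis .
qed

text \<open>Paths and holding times are independent, so the event of overlapping after
  \<open>i\<close> and \<open>j\<close> jumps at a common vertex has probability
  \<open>overlap_prob i j * meeting_prob G i j x\<close>. Almost surely finitely many such pairs
  occur, and the clocks do not explode, so \<open>finite_collision_times\<close> applies.\<close>

lemma continuous_finite_collisionI:
  fixes G :: "'v::countable graph"
  assumes G: "lf_graph G" and fin: "\<And>x. x \<in> verts G \<Longrightarrow> total_meetings overlap_prob G x < \<infinity>"
  shows "continuous_finite_collision G"
  unfolding continuous_finite_collision_def
proof (intro ballI allI impI)
  fix x \<mu> assume x: "x \<in> verts G" and \<mu>: "srw_law G x \<mu>"
  interpret \<mu>: prob_space \<mu> by (rule prob_space_srw_law[OF \<mu>])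
  interpret H: prob_space holding_law by (rule prob_space_holding_law)
  interpret L: pair_prob_space \<mu> holding_law ..
  interpret LL: pair_prob_space "\<mu> \<Otimes>\<^sub>M holding_law" "\<mu> \<Otimes>\<^sub>M holding_law" ..
  note [measurable] = measurable_srw_law[OF \<mu>]
  let ?L = "\<mu> \<Otimes>\<^sub>M holding_law"
  have law: "ctime_srw_law \<mu> = ?L" by (simp add: ctime_srw_law_def holding_law_def)
  define A where "A i j = {\<omega> \<in> space (?L \<Otimes>\<^sub>M ?L). fst (fst \<omega>) i = fst (snd \<omega>) j \<and>
    overlap i j (snd (fst \<omega>)) (snd (snd \<omega>))}" for i j
  have A [measurable]: "A i j \<in> sets (?L \<Otimes>\<^sub>M ?L)" for i j unfolding A_def by measurable
  have "emeasure (?L \<Otimes>\<^sub>M ?L) (A i j) \<le> overlap_prob i j * meeting_prob G i j x" for i j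
  proof -
    let ?f = "\<lambda>z. (if fst z i = snd z j then 1 else 0) :: ennreal"
    let ?g = "\<lambda>z. (if overlap i j (fst z) (snd z) then 1 else 0) :: ennreal"
    have "emeasure (?L \<Otimes>\<^sub>M ?L) (A i j) = (\<integral>\<^sup>+\<omega>. indicator (A i j) \<omega> \<partial>(?L \<Otimes>\<^sub>M ?L))"
      by simp
    also have "\<dots> = (\<integral>\<^sup>+\<omega>. ?f (fst (fst \<omega>), fst (snd \<omega>)) * ?g (snd (fst \<omega>), snd (snd \<omega>)) \<partial>(?L \<Otimes>\<^sub>M ?L))"
      by (rule nn_integral_cong) (simp add: A_def indicator_def)
    also have "\<dots> = (\<integral>\<^sup>+z. ?f z \<partial>(\<mu> \<Otimes>\<^sub>M \<mu>)) * (\<integral>\<^sup>+z. ?g z \<partial>(holding_law \<Otimes>\<^sub>M holding_law))"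
      by (rule nn_integral_pair_pair_mult) (unfold_locales, measurable)
    also have "(\<integral>\<^sup>+z. ?g z \<partial>(holding_law \<Otimes>\<^sub>M holding_law)) = overlap_prob i j"
      unfolding overlap_prob_def by (subst H.nn_integral_fst[symmetric]) simp_all
    also have "(\<integral>\<^sup>+z. ?f z \<partial>(\<mu> \<Otimes>\<^sub>M \<mu>)) =
        (\<integral>\<^sup>+z. indicator {\<omega> \<in> space (\<mu> \<Otimes>\<^sub>M \<mu>). fst \<omega> i = snd \<omega> j} z \<partial>(\<mu> \<Otimes>\<^sub>M \<mu>))"
      by (rule nn_integral_cong) (simp add: indicator_def)
    also have "\<dots> = meeting_prob G i j x"
      unfolding srw_law_meeting[OF G \<mu>, symmetric] by (rule nn_integral_indicator) measurable
    finally show ?thesis by (simp add: mult.commute)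
  qed
  then have meetings: "AE \<omega> in ?L \<Otimes>\<^sub>M ?L. finite {(i, j). \<omega> \<in> A i j}"
    by (rule LL.P.AE_finite_meetings[OF A _ fin[OF x]])
  have "AE Z in \<mu>. AE \<xi> in holding_law. nonexplosive (snd (Z, \<xi>))"
    using AE_nonexplosive by simp
  then have good: "AE a in ?L. nonexplosive (snd a)"
    by (intro L.AE_pair_measure) (simp_all, measurable)
  then have "AE a in ?L. AE b in ?L. nonexplosive (snd (fst (a, b))) \<and> nonexplosive (snd (snd (a, b)))"
  proof eventually_elim
    case (elim a)
    from good show ?case by eventually_elim (simp add: elim)
  qed
  then have "AE \<omega> in ?L \<Otimes>\<^sub>M ?L. nonexplosive (snd (fst \<omega>)) \<and> nonexplosive (snd (snd \<omega>))"
    by (intro LL.AE_pair_measure) (simp_all, measurable)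
  with meetings AE_space
  have "AE \<omega> in ?L \<Otimes>\<^sub>M ?L. finite {t. t \<ge> 0 \<and> left_limit (ctime_path (fst \<omega>)) t \<noteq> left_limit (ctime_path (snd \<omega>)) t \<and>
                      ctime_path (fst \<omega>) t = ctime_path (snd \<omega>) t}"
  proof eventually_elim
    case (elim \<omega>)
    obtain Z \<xi> W \<eta> where \<omega>: "\<omega> = ((Z, \<xi>), (W, \<eta>))" by (metis surj_pair)
    have "{(i, j). Z i = W j \<and> overlap i j \<xi> \<eta>} = {(i, j). \<omega> \<in> A i j}"
      using elim by (simp add: A_def \<omega>)
    with elim have "finite {(i, j). Z i = W j \<and> overlap i j \<xi> \<eta>}" by simp
    with elim show ?case unfolding \<omega> fst_conv snd_conv by (intro finite_collision_times) auto
  qed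
  then show "AE (a, b) in ctime_srw_law \<mu> \<Otimes>\<^sub>M ctime_srw_law \<mu>.
      finite {t. t \<ge> 0 \<and> left_limit (ctime_path a) t \<noteq> left_limit (ctime_path b) t \<and>
                 ctime_path a t = ctime_path b t}"
    unfolding law split_beta .
qed

theorem theorem2:
  fixes M :: "'w measure" and X :: "'w \<Rightarrow> rooted_graph"
  assumes "prob_space M" and "X \<in> borel_measurable M" and "unimodular M X"
    and "(\<integral>\<^sup>+\<omega>. of_nat (vertex_degree (graph_of (X \<omega>)) (root_of (X \<omega>))) *
            (\<Sum>n. ennreal (trans_fun_n (graph_of (X \<omega>)) n (root_of (X \<omega>)) (root_of (X \<omega>)))) \<partial>M) < \<infinity>"
  shows "AE \<omega> in M. discrete_finite_collision (graph_of (X \<omega>)) \<and>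
                     continuous_finite_collision (graph_of (X \<omega>))"
  using AE_total_meetings[OF assms(2-4), of "\<lambda>i j. if i = j then 1 else 0", OF sum_diagonal_weight_le]
    AE_total_meetings[OF assms(2-4), of overlap_prob, OF sum_overlap_prob_le]
proof eventually_elim
  case (elim \<omega>)
  \<comment> \<open>Both families of totals are finite at every vertex: the diagonal weights give
    the discrete property, \<open>overlap_prob\<close> the continuous one.\<close>
  then show ?case
    using discrete_finite_collisionI[OF lf_graph_of] continuous_finite_collisionI[OF lf_graph_of] by blast
qed

end
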